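(* Let $q$ be a prime power, let $2\le e\le 6$, let $r$ be a positive integer, let $a\in\mathbb{F}_{q^e}$ with $a\neq 0$, let $f(x)=x^r(x^{q-1}+a)\in\mathbb{F}_{q^e}[x]$, and let $\ell=q^{e-1}+\cdots+q+1$. (i) If $e\in\{2,3,4\}$, then $f(x)$ permutes $\mathbb{F}_{q^e}$ if and only if $(-a)^{\ell}\neq 1$, $\gcd(r,q-1)=1$, and $r \bmod \ell\in\{1,\ell-q\}$. (ii) If $e=5$ and $q$ is an odd prime, then $f(x)$ permutes $\mathbb{F}_{q^5}$ if and only if $(-a)^{\ell}\neq 1$, $\gcd(r,q-1)=1$, and $r\bmod \ell\in\{1,\ell-q,q^3+1,q^4+q^2+1\}$. (iii) If $e=6$ and $q$ is an odd prime, then $f(x)$ permutes $\mathbb{F}_{q^6}$ if and only if $(-a)^{\ell}\neq 1$, $\gcd(r,q-1)=1$, and $r\bmod \ell\in\{1,\ell-q\}$.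
   Context: A polynomial permutes $\mathbb{F}_{q^e}$ if the map $x\mapsto f(x)$ is a bijection of $\mathbb{F}_{q^e}$. For integers $r$ and $\ell\ge 1$, $r\bmod \ell$ denotes the least nonnegative residue of $r$ modulo $\ell$. *)

theory Defs
  imports "HOL-Number_Theory.Number_Theory"
begin

definition fpoly :: "nat \<Rightarrow> nat \<Rightarrow> 'a::field \<Rightarrow> 'a \<Rightarrow> 'a" where
  "fpoly q r a x = x ^ r * (x ^ (q - 1) + a)"

definition ell :: "nat \<Rightarrow> nat \<Rightarrow> nat" where
  "ell q e = (\<Sum>i<e. q ^ i)"

end

theory Submission
  imports Defs "HOL-Computational_Algebra.Polynomial"
begin

text \<open>
  Write \<open>l = ell q e\<close> and \<open>L = ell q (e - 1)\<close>. Suppose that \<open>f\<close> is a bijection. Expanding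
  the power sum of \<open>f x ^ ((q - 1) * k)\<close>, which vanishes for \<open>0 < k < l\<close>, shows that
  the sum of \<open>binomial ((q - 1) * k) i * a ^ ((q - 1) * k - i)\<close> over all \<open>i\<close> with
  \<open>l dvd r * k + i\<close> is zero. For well-chosen \<open>k\<close> at most two terms remain, and Lucas'
  theorem decides which of them are nonzero. The choice \<open>k = L\<close> gives
  \<open>r = - q * j\<close> modulo \<open>l\<close> with \<open>1 \<le> j \<le> L\<close>, and the substitution of \<open>1 / x\<close> for \<open>x\<close>
  exchanges \<open>j\<close> and \<open>L + 1 - j\<close>, so that one may assume \<open>2 * j \<le> L + 1\<close>.
  Further choices of \<open>k\<close>, depending on \<open>e\<close>, leave only \<open>j = 1\<close>, and \<open>j = q ^ 2 + 1\<close> for \<open>e = 5\<close>.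

  Conversely, each residue in the list is the inverse modulo \<open>l\<close> of some \<open>ell q m\<close>, and this
  makes \<open>f\<close> injective by a comparison of norms.
\<close>

section \<open>Recursions for the numbers \<open>ell q m\<close>\<close>

lemma ell_0 [simp]: "ell q 0 = 0"
  by (simp add: ell_def)

lemma ell_Suc: "ell q (Suc m) = ell q m + q ^ m"
  by (simp add: ell_def)

lemma ell_Suc': "ell q (Suc m) = 1 + q * ell q m"
proof (induction m)
  case (Suc m)
  have "ell q (Suc (Suc m)) = 1 + q * ell q m + q * q ^ m"
    unfolding ell_Suc[of q "Suc m"] Suc by simp
  then show ?case
    by (simp add: ell_Suc[of q m] distrib_left)
qed (simp add: ell_Suc)

lemma ell_pos: "0 < m \<Longrightarrow> 0 < ell q m"
  by (cases m) (simp_all add: ell_Suc')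

lemma diff_one_times_ell: "(q - 1) * ell q m = q ^ m - 1"
  using ell_Suc[of q m] ell_Suc'[of q m] by (simp add: diff_mult_distrib)

section \<open>Binomial coefficients and power sums in a finite field\<close>

text \<open>The field with \<open>q ^ e\<close> elements is the type \<open>'a\<close> itself, known
  only by its cardinality; \<open>ty\<close> makes this type a parameter of the locale.\<close>

locale finite_field_extension =
  fixes q e :: nat and ty :: "'a::{field,finite} itself"
  assumes primepow_q: "primepow q"
    and card_field: "card (UNIV :: 'a set) = q ^ e"
    and e_ge_2: "2 \<le> e"
begin

lemma q_gt_1: "1 < q"
  using primepow_gt_Suc_0[OF primepow_q] by simp

lemma prime_CHAR: "prime CHAR('a)"
  by (simp add: prime_CHAR_semidom finite_imp_CHAR_pos)

text \<open>The characteristic divides the order \<open>q ^ e\<close>, and \<open>q\<close> has a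
  single prime divisor.\<close>

lemma q_eq_CHAR_power: obtains n where "0 < n" "q = CHAR('a) ^ n"
proof -
  obtain p n where p: "prime p" "0 < n" "q = p ^ n"
    using primepow_q by (auto simp: primepow_def)
  have "CHAR('a) dvd p ^ (n * e)"
    using CHAR_dvd_CARD[where ?'a = 'a] by (simp add: card_field p power_mult)
  then have "CHAR('a) = p"
    using p(1) prime_CHAR prime_dvd_power primes_dvd_imp_eq by blast
  with p that show thesis by blast
qed

lemma CHAR_dvd_q: "CHAR('a) dvd q"
  by (rule q_eq_CHAR_power) simp

lemma of_nat_q [simp]: "(of_nat q :: 'a) = 0"
  using CHAR_dvd_q by (simp add: of_nat_eq_0_iff_char_dvd)

text \<open>A ring other than the field itself is allowed, so that the identity also applies to
  polynomials over it.\<close>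

lemma frobenius_add:
  fixes x y :: "'b::comm_semiring_1"
  assumes "CHAR('b) = CHAR('a)"
  shows "(x + y) ^ q ^ m = x ^ q ^ m + y ^ q ^ m"
proof -
  obtain n where "q = CHAR('a) ^ n"
    using q_eq_CHAR_power by blast
  then have "q ^ m = CHAR('b) ^ (n * m)"
    by (simp add: assms power_mult)
  then show ?thesis
    using freshmans_dream' prime_CHAR assms by metis
qed

section \<open>Binomial coefficients as elements of the field\<close>

lemma coeff_one_plus_X_power: "Polynomial.coeff ([:1, 1:] ^ n) k = (of_nat (n choose k) :: 'a)"
proof (induction n arbitrary: k)
  case 0
  then show ?case by (cases k) simp_all
next
  case (Suc n)
  show ?case
    by (cases k) (simp_all add: Suc coeff_pCons)
qed

text \<open>Compare coefficients in
  \<open>(1 + X) ^ (n + q ^ m) = (1 + X) ^ n * (1 + X ^ q ^ m)\<close>.\<close>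

lemma of_nat_add_q_power_choose:
  "(of_nat ((n + q ^ m) choose k) :: 'a) =
     of_nat (n choose k) + (if q ^ m \<le> k then of_nat (n choose (k - q ^ m)) else 0)"
proof -
  have one: "[:1, 1:] = 1 + Polynomial.monom (1::'a) 1"
    by (simp add: monom_altdef one_pCons)
  have "[:1, 1:] ^ q ^ m = 1 + Polynomial.monom (1::'a) (q ^ m)"
    unfolding one by (subst frobenius_add) (simp_all add: monom_power)
  then have "[:1, 1:] ^ (n + q ^ m) = [:1, 1:] ^ n + Polynomial.monom (1::'a) (q ^ m) * [:1, 1:] ^ n"
    by (simp add: power_add algebra_simps)
  then have "Polynomial.coeff ([:1, 1:] ^ (n + q ^ m)) k =
      Polynomial.coeff ([:1, 1:] ^ n + Polynomial.monom (1::'a) (q ^ m) * [:1, 1:] ^ n) k"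
    by simp
  then show ?thesis
    by (simp add: coeff_one_plus_X_power coeff_monom_mult del: power_add)
qed

text \<open>One step of Lucas' theorem in base \<open>q ^ m\<close>. Raising \<open>D\<close> by one
  adds \<open>q ^ m\<close> to the upper entry, and the preceding recursion then becomes Pascal's
  rule for \<open>D choose U\<close>.\<close>

lemma lucas_step:
  assumes "d < q ^ m" "u < q ^ m"
  shows "(of_nat ((d + q ^ m * D) choose (u + q ^ m * U)) :: 'a) =
           of_nat (d choose u) * of_nat (D choose U)"
proof (induction D arbitrary: U)
  case 0
  then show ?case
    using assms by (cases U) (simp_all add: binomial_eq_0)
next
  case (Suc D)
  have eq: "d + q ^ m * Suc D = d + q ^ m * D + q ^ m"
    by simp
  show ?case
  proof (cases U)
    case 0
    then show ?thesis
      unfolding eq of_nat_add_q_power_choose using assms Suc[of 0] by simp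
  next
    case (Suc U')
    have "u + q ^ m * U - q ^ m = u + q ^ m * U'"
      by (simp add: Suc)
    then show ?thesis
      unfolding eq of_nat_add_q_power_choose using Suc.IH[of U] Suc.IH[of U']
      by (simp add: Suc algebra_simps)
  qed
qed

text \<open>Neighbouring entries of row \<open>q ^ m - 1\<close> add up to an entry of row
  \<open>q ^ m\<close>, which vanishes strictly inside the row; so the signs alternate.\<close>

lemma of_nat_q_power_minus_1_choose:
  "u < q ^ m \<Longrightarrow> (of_nat ((q ^ m - 1) choose u) :: 'a) = (- 1) ^ u"
proof (induction u)
  case (Suc u)
  have "(of_nat (q ^ m choose Suc u) :: 'a) = 0"
    using of_nat_add_q_power_choose[of 0 m "Suc u"] Suc.prems by simp
  moreover have "q ^ m choose Suc u = ((q ^ m - 1) choose u) + ((q ^ m - 1) choose Suc u)"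
    using Suc.prems by (cases "q ^ m") simp_all
  ultimately have "(of_nat ((q ^ m - 1) choose u) + of_nat ((q ^ m - 1) choose Suc u) :: 'a) = 0"
    by (metis of_nat_add)
  then show ?case
    using Suc by (simp add: add_eq_0_iff)
qed simp

lemma of_nat_q_minus_1_choose:
  "u < q \<Longrightarrow> (of_nat ((q - 1) choose u) :: 'a) = (- 1) ^ u"
  using of_nat_q_power_minus_1_choose[of u 1] by simp

text \<open>By Pascal's rule and the alternating signs of row \<open>q - 1\<close>, the signed
  entries of row \<open>q - 2\<close> grow by one at each step.\<close>

lemma of_nat_q_minus_2_choose:
  "u < q \<Longrightarrow> (of_nat ((q - 2) choose u) :: 'a) = (- 1) ^ u * of_nat (u + 1)"
proof (induction u)
  case (Suc u)
  have "q - 1 = Suc (q - 2)"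
    using q_gt_1 by simp
  then have "(q - 1) choose Suc u = ((q - 2) choose u) + ((q - 2) choose Suc u)"
    by simp
  then have "(of_nat ((q - 1) choose Suc u) :: 'a) =
      of_nat ((q - 2) choose u) + of_nat ((q - 2) choose Suc u)"
    by (metis of_nat_add)
  then show ?case
    using Suc of_nat_q_minus_1_choose[of "Suc u"] by (simp add: algebra_simps eq_neg_iff_add_eq_0)
qed simp

text \<open>A prime \<open>q\<close> is the characteristic and does not divide \<open>fact d\<close>
  for \<open>d < q\<close>. Primality matters: for \<open>q = 4\<close> the coefficient
  \<open>2 choose 1\<close> is zero.\<close>

lemma of_nat_choose_neq_0:
  assumes "prime q" "u \<le> d" "d < q"
  shows "(of_nat (d choose u) :: 'a) \<noteq> 0"
proof
  assume "(of_nat (d choose u) :: 'a) = 0"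
  moreover have "CHAR('a) = q"
    using CHAR_dvd_q prime_CHAR assms(1) primes_dvd_imp_eq by blast
  ultimately have "q dvd (d choose u)"
    by (simp add: of_nat_eq_0_iff_char_dvd)
  then have "q dvd fact d"
    using binomial_fact_lemma[OF assms(2)] by (metis dvd_mult)
  then show False
    using assms by (simp add: prime_dvd_fact_iff)
qed

section \<open>Power sums over the field\<close>

lemma power_card_minus_1:
  fixes x :: 'a
  assumes "x \<noteq> 0"
  shows "x ^ (q ^ e - 1) = 1"
proof -
  have "(\<Prod>y\<in>UNIV-{0}. x * y) = (\<Prod>y\<in>UNIV-{0}. y)"
    by (rule prod.reindex_bij_witness[of _ "\<lambda>y. y / x" "\<lambda>y. x * y"]) (use assms in auto)
  moreover have "(\<Prod>y\<in>UNIV-{0}. x * y) = x ^ (q ^ e - 1) * \<Prod>(UNIV-{0::'a})"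
    by (simp add: prod.distrib card_field)
  moreover have "\<Prod>(UNIV-{0::'a}) \<noteq> 0"
    by simp
  ultimately show ?thesis
    by simp
qed

lemmas power_card_minus_1' = power_card_minus_1[unfolded One_nat_def]

lemma q_power_e_gt_1: "1 < q ^ e"
  using q_gt_1 e_ge_2 by (intro one_less_power) simp_all

lemma card_roots_of_unity_le:
  assumes "0 < n"
  shows "card {x::'a. x ^ n = 1} \<le> n"
proof -
  have deg: "Polynomial.degree (Polynomial.monom (1::'a) n - 1) = n"
    using assms unfolding diff_conv_add_uminus
    by (subst degree_add_eq_left) (simp_all add: degree_monom_eq)
  then have "Polynomial.monom (1::'a) n - 1 \<noteq> 0"
    using assms by force
  from card_poly_roots_bound[OF this] show ?thesis
    by (simp add: deg poly_monom)
qed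

text \<open>The equation \<open>x ^ n = 1\<close> has at most \<open>n\<close> solutions, fewer than
  there are nonzero elements.\<close>

lemma exists_power_neq_1:
  assumes "0 < n" "n < q ^ e - 1"
  obtains x :: 'a where "x \<noteq> 0" "x ^ n \<noteq> 1"
proof -
  have "\<not> UNIV - {0} \<subseteq> {x::'a. x ^ n = 1}"
  proof
    assume sub: "UNIV - {0} \<subseteq> {x::'a. x ^ n = 1}"
    have "card (UNIV - {0::'a}) \<le> n"
      using card_mono[OF _ sub] card_roots_of_unity_le[OF assms(1)] by fastforce
    then show False
      using assms by (simp add: card_field)
  qed
  then show thesis
    using that by blast
qed

text \<open>If \<open>q ^ e - 1\<close> does not divide \<open>M\<close>, scaling the variable by
  some \<open>y\<close> with \<open>y ^ M \<noteq> 1\<close> multiplies the sum by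
  \<open>y ^ M\<close>, so it is zero. The case \<open>M = 0\<close> is separate because
  \<open>0 ^ 0 = 1\<close> adds a term and the sum becomes \<open>q ^ e\<close>, which is zero in
  the field.\<close>

lemma sum_power_UNIV:
  "(\<Sum>x\<in>UNIV. x ^ M) = (if 0 < M \<and> (q ^ e - 1) dvd M then - 1 else (0::'a))"
proof (cases "(q ^ e - 1) dvd M")
  case True
  then obtain c where c: "M = (q ^ e - 1) * c"
    by blast
  have card0: "(of_nat (q ^ e) :: 'a) = 0"
    using e_ge_2 by simp
  show ?thesis
  proof (cases "M = 0")
    case False
    have "(\<Sum>x\<in>UNIV. x ^ M) = (\<Sum>x\<in>UNIV-{0}. (x::'a) ^ M)"
      using False by (subst sum.remove[of _ 0]) simp_all
    also have "\<dots> = (\<Sum>x\<in>UNIV-{0::'a}. 1)"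
      by (rule sum.cong) (simp_all add: c power_mult power_card_minus_1')
    also have "\<dots> = of_nat (q ^ e - 1)"
      by (simp add: card_field)
    also have "\<dots> = - 1"
      using card0 q_power_e_gt_1 by (subst of_nat_diff) simp_all
    finally show ?thesis
      using False True by simp
  qed (use card0 card_field in simp)
next
  case False
  define m where "m = M mod (q ^ e - 1)"
  have "0 < m" "m < q ^ e - 1"
    using False q_power_e_gt_1 by (auto simp: m_def dvd_eq_mod_eq_0)
  then obtain y :: 'a where y: "y \<noteq> 0" "y ^ m \<noteq> 1"
    using exists_power_neq_1 by blast
  have "y ^ M = y ^ ((q ^ e - 1) * (M div (q ^ e - 1)) + m)"
    unfolding m_def by simp
  also have "\<dots> = y ^ m"
    using y(1) by (simp add: power_add power_mult power_card_minus_1')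
  finally have yM: "y ^ M \<noteq> 1"
    using y by simp
  have "(\<Sum>x\<in>UNIV. x ^ M) = (\<Sum>x\<in>UNIV. (y * x) ^ M)"
    by (rule sum.reindex_bij_witness[of _ "\<lambda>x. y * x" "\<lambda>x. x / y"]) (use y in auto)
  also have "\<dots> = y ^ M * (\<Sum>x\<in>UNIV. x ^ M)"
    by (simp add: power_mult_distrib sum_distrib_left)
  finally show ?thesis
    using yM False by simp
qed

section \<open>Hermite sums and the sufficient condition\<close>

abbreviation l where "l \<equiv> ell q e"

lemma q_minus_1_times_l: "(q - 1) * l = q ^ e - 1"
  by (rule diff_one_times_ell)

text \<open>Powers divisible by \<open>q - 1\<close> are used because all exponents of
  \<open>x\<close> in the expansion then have the form \<open>(q - 1) * (r * k + i)\<close>, and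
  divisibility by \<open>q ^ e - 1 = (q - 1) * l\<close> reduces to divisibility by
  \<open>l\<close>.\<close>

lemma hermite_sum:
  fixes a :: 'a
  assumes bij: "bij (fpoly q r a)" and r: "0 < r" and k: "0 < k" "k < l"
  shows "(\<Sum>i | i \<le> (q - 1) * k \<and> l dvd r * k + i.
            of_nat (((q - 1) * k) choose i) * a ^ ((q - 1) * k - i)) = 0"
proof -
  define S where "S = (q - 1) * k"
  have S: "0 < S" "S < q ^ e - 1"
    unfolding S_def q_minus_1_times_l[symmetric] using k q_gt_1 by simp_all
  have "(\<Sum>x\<in>UNIV. fpoly q r a x ^ S) = (\<Sum>x\<in>UNIV. x ^ S)"
    by (rule sum.reindex_bij_betw[OF bij])
  also have "\<dots> = 0"
    using S by (auto simp: sum_power_UNIV dest: dvd_imp_le)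
  finally have "0 = (\<Sum>x\<in>UNIV. fpoly q r a x ^ S)"
    by simp
  also have "\<dots> = (\<Sum>x\<in>UNIV. \<Sum>i\<le>S. of_nat (S choose i) * a ^ (S - i) * x ^ ((q - 1) * (r * k + i)))"
  proof (rule sum.cong)
    fix x :: 'a
    have "fpoly q r a x ^ S = x ^ (r * S) * (x ^ (q - 1) + a) ^ S"
      by (simp add: fpoly_def power_mult_distrib power_mult)
    also have "(x ^ (q - 1) + a) ^ S = (\<Sum>i\<le>S. of_nat (S choose i) * (x ^ (q - 1)) ^ i * a ^ (S - i))"
      by (rule binomial_ring)
    also have "x ^ (r * S) * \<dots> = (\<Sum>i\<le>S. of_nat (S choose i) * a ^ (S - i) * x ^ ((q - 1) * (r * k + i)))"
      unfolding sum_distrib_left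
      by (rule sum.cong) (simp_all add: S_def algebra_simps flip: power_mult power_add)
    finally show "fpoly q r a x ^ S =
        (\<Sum>i\<le>S. of_nat (S choose i) * a ^ (S - i) * x ^ ((q - 1) * (r * k + i)))" .
  qed simp
  also have "\<dots> = (\<Sum>i\<le>S. of_nat (S choose i) * a ^ (S - i) * (\<Sum>x\<in>UNIV. x ^ ((q - 1) * (r * k + i))))"
    by (subst sum.swap) (simp add: sum_distrib_left)
  also have "\<dots> = (\<Sum>i\<le>S. if l dvd r * k + i then - (of_nat (S choose i) * a ^ (S - i)) else 0)"
    unfolding sum_power_UNIV q_minus_1_times_l[symmetric]
    using q_gt_1 r k by (intro sum.cong) simp_all
  also have "\<dots> = - (\<Sum>i | i \<le> S \<and> l dvd r * k + i. of_nat (S choose i) * a ^ (S - i))"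
    by (subst sum.inter_filter[symmetric]) (simp_all add: sum_negf)
  finally show ?thesis
    by (simp add: S_def)
qed

text \<open>The indices that occur form one residue class modulo \<open>l\<close>, which has at most
  the two members \<open>i\<close> and \<open>i + l\<close> up to \<open>S < 2 * l\<close>. An index
  beyond \<open>S\<close> is harmless, its binomial coefficient being zero.\<close>

lemma hermite_two_terms:
  fixes a :: 'a
  assumes bij: "bij (fpoly q r a)" and r: "0 < r" and k: "0 < k" "k < l"
    and S: "(q - 1) * k = S" "S < 2 * l" and i: "i < l" "l dvd r * k + i"
  shows "of_nat (S choose i) * a ^ (S - i) + of_nat (S choose (i + l)) * a ^ (S - (i + l)) = 0"
proof -
  have "i' = i \<or> i' = i + l" if "i' \<le> S" "l dvd r * k + i'" for i'
  proof -
    have "[r * k + i' = r * k + i] (mod l)"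
      using that i(2) by (simp add: cong_def)
    then have "i' mod l = i"
      using i(1) by (simp add: cong_def cong_add_lcancel_nat[unfolded cong_def])
    then have eq: "i' = i + l * (i' div l)"
      by (metis add.commute mult_div_mod_eq)
    have "i' < l * 2"
      using that(1) S(2) by linarith
    then have "i' div l < 2"
      by (simp add: less_mult_imp_div_less mult.commute)
    then have "i' div l = 0 \<or> i' div l = 1"
      by linarith
    with eq show ?thesis
      by fastforce
  qed
  then have sub: "{i'. i' \<le> S \<and> l dvd r * k + i'} \<subseteq> {i, i + l}"
    by blast
  have "l dvd r * k + (i + l)"
    using i(2) by (simp flip: add.assoc)
  then have "(\<Sum>i' | i' \<le> S \<and> l dvd r * k + i'. of_nat (S choose i') * a ^ (S - i')) =
      (\<Sum>i'\<in>{i, i + l}. of_nat (S choose i') * a ^ (S - i'))"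
    using i(2) by (intro sum.mono_neutral_left[OF _ sub]) (auto simp: binomial_eq_0)
  also have "\<dots> = of_nat (S choose i) * a ^ (S - i) + of_nat (S choose (i + l)) * a ^ (S - (i + l))"
    using i(1) by simp
  finally show ?thesis
    using hermite_sum[OF bij r k] S(1) by simp
qed

text \<open>Since \<open>S < l\<close>, the second index \<open>i + l\<close> lies beyond
  \<open>S\<close>, and the power of \<open>a\<close> cancels.\<close>

lemma hermite_one_term:
  fixes a :: 'a
  assumes "bij (fpoly q r a)" and "0 < r" and "a \<noteq> 0" and "0 < k"
    and S: "(q - 1) * k = S" "S < l" and i: "l dvd r * k + i"
  shows "(of_nat (S choose i) :: 'a) = 0"
proof (cases "i \<le> S")
  case True
  have "1 * k \<le> (q - 1) * k"
    using q_gt_1 by (intro mult_right_mono) simp_all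
  with S have "k < l"
    by simp
  with hermite_two_terms[OF assms(1,2,4) this S(1) _ _ i] True S assms(3) show ?thesis
    by (simp add: binomial_eq_0)
qed (simp add: binomial_eq_0)

lemma exists_q_minus_1_root:
  fixes z :: 'a
  assumes "z ^ l = 1"
  obtains x where "x \<noteq> 0" "x ^ (q - 1) = z"
proof -
  have l_pos: "0 < l"
    using e_ge_2 by (simp add: ell_pos)
  then have z: "z \<noteq> 0"
    using assms by (auto simp: power_0_left)
  define G where "G x = (\<Sum>i<l. z ^ (l - Suc i) * (x ^ (q - 1)) ^ i)" for x
  have factor: "x ^ (q ^ e - 1) - 1 = (x ^ (q - 1) - z) * G x" for x
    unfolding q_minus_1_times_l[symmetric] power_mult G_def
    using power_diff_sumr2[of "x ^ (q - 1)" l z] by (simp add: assms)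
  have "\<exists>x. x \<noteq> 0 \<and> x ^ (q - 1) = z"
  proof (rule ccontr)
    assume "\<not> ?thesis"
    then have "G x = 0" if "x \<noteq> 0" for x
      using factor[of x] that power_card_minus_1[of x] by auto
    then have "(\<Sum>x\<in>UNIV. G x) = G 0"
      by (subst sum.remove[of _ 0]) simp_all
    also have "G 0 = z ^ (l - 1)"
      using l_pos q_gt_1
      by (simp add: G_def power_0_left if_distrib[of "\<lambda>y. _ * y"] sum.delta cong: if_cong)
    finally have "(\<Sum>x\<in>UNIV. G x) \<noteq> 0"
      using z by simp
    moreover have "(\<Sum>x\<in>UNIV. G x) = (\<Sum>i<l. z ^ (l - Suc i) * (\<Sum>x\<in>UNIV. x ^ ((q - 1) * i)))"
      unfolding G_def by (subst sum.swap) (simp add: sum_distrib_left flip: power_mult)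
    moreover have "(\<Sum>x\<in>UNIV. (x::'a) ^ ((q - 1) * i)) = 0" if "i < l" for i
      unfolding sum_power_UNIV q_minus_1_times_l[symmetric]
      using that q_gt_1 by (auto dest: dvd_imp_le)
    ultimately show False
      by simp
  qed
  with that show thesis
    by blast
qed

text \<open>If the norm of \<open>- a\<close> is one, then \<open>- a\<close> is a value of
  \<open>x ^ (q - 1)\<close>, and this \<open>x\<close> is a second zero of the polynomial.\<close>

lemma bij_imp_norm_neq_1:
  fixes a :: 'a
  assumes "bij (fpoly q r a)" and "0 < r"
  shows "(- a) ^ l \<noteq> 1"
proof
  assume "(- a) ^ l = 1"
  then obtain x where x: "x \<noteq> 0" "x ^ (q - 1) = - a"
    using exists_q_minus_1_root by blast
  then have "fpoly q r a x = fpoly q r a 0"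
    using assms(2) by (simp add: fpoly_def)
  with x(1) assms(1) show False
    by (simp add: bij_is_inj inj_eq)
qed

text \<open>A common divisor \<open>d > 1\<close> of \<open>r\<close> and \<open>q - 1\<close>
  yields a nontrivial \<open>d\<close>-th root of unity, at which the polynomial takes the same
  value as at 1.\<close>

lemma bij_imp_coprime:
  fixes a :: 'a
  assumes "bij (fpoly q r a)" and "0 < r"
  shows "gcd r (q - 1) = 1"
proof (rule ccontr)
  define d where "d = gcd r (q - 1)"
  assume "gcd r (q - 1) \<noteq> 1"
  then have d: "1 < d" "d dvd r" "d dvd q - 1"
    using assms(2) by (auto simp: d_def nat_neq_iff)
  have "d dvd q ^ e - 1"
    using d(3) unfolding q_minus_1_times_l[symmetric] by simp
  then obtain n where n: "q ^ e - 1 = d * n"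
    by blast
  have "0 < d * n"
    using q_power_e_gt_1 by (simp flip: n)
  then have "0 < n" "n < q ^ e - 1"
    using d(1) unfolding n by simp_all
  then obtain x :: 'a where x: "x \<noteq> 0" "x ^ n \<noteq> 1"
    using exists_power_neq_1 by blast
  have xd: "(x ^ n) ^ d = 1"
    using power_card_minus_1[OF x(1)] unfolding n by (simp add: mult.commute flip: power_mult)
  have "(x ^ n) ^ m = 1" if "d dvd m" for m
    using that xd by (auto simp: power_mult elim!: dvdE)
  then have "fpoly q r a (x ^ n) = fpoly q r a 1"
    using d by (simp add: fpoly_def)
  with x(2) assms(1) show False
    by (simp add: bij_is_inj inj_eq)
qed

section \<open>Norms and the converse direction\<close>

lemma l_eq: "l = 1 + q * ell q (e - 1)" "l = ell q (e - 1) + q ^ (e - 1)"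
  using e_ge_2 ell_Suc[of q "e - 1"] ell_Suc'[of q "e - 1"] by simp_all

text \<open>The norm is invariant under Frobenius: \<open>q * l\<close> and \<open>l\<close> differ
  by \<open>q ^ e - 1\<close>.\<close>

lemma power_q_power_l: "((z::'a) ^ q ^ m) ^ l = z ^ l"
proof (induction m)
  case (Suc m)
  have "(z ^ q) ^ l = z ^ l" for z :: 'a
  proof (cases "z = 0")
    case False
    have "q * l = l + (q ^ e - 1)"
      using q_minus_1_times_l q_gt_1 by (cases q) simp_all
    then show ?thesis
      using False by (simp add: power_add power_card_minus_1' flip: power_mult)
  qed (use l_eq(1) q_gt_1 in \<open>simp add: power_0_left\<close>)
  from this[of "z ^ q ^ m"] Suc show ?case
    by (simp add: mult.commute flip: power_mult)
qed simp

lemma l_gt_1: "1 < l"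
proof -
  have "0 < ell q (e - 1)"
    using e_ge_2 by (simp add: ell_pos)
  then show ?thesis
    using l_eq(1) q_gt_1 by simp
qed

text \<open>If \<open>y = v * x\<close> has the same image as \<open>x\<close>, then \<open>x ^ (q - 1) * (v ^ (r + q - 1) - 1) = - a * (v ^ r - 1)\<close>.
  The congruence makes \<open>v ^ (r + q - 1)\<close> a conjugate of \<open>v ^ r\<close>, so taking norms gives \<open>v ^ r = 1\<close>.\<close>

lemma bij_fpoly:
  fixes a :: 'a
  assumes r: "0 < r" and norm: "(- a) ^ l \<noteq> 1" and cop: "gcd r (q - 1) = 1"
    and inv: "[r * ell q m = 1] (mod l)"
  shows "bij (fpoly q r a)"
proof -
  obtain w where w: "r * ell q m = 1 + l * w"
  proof -
    have "r * ell q m \<noteq> 0"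
      using inv l_gt_1 by (metis cong_def mod_0 mod_less zero_neq_one)
    then have "1 \<le> r * ell q m"
      by linarith
    then obtain w where "r * ell q m = w * l + 1"
      using inv cong_le_nat by blast
    then show thesis
      using that[of w] by (simp add: mult.commute)
  qed
  have "r * q ^ m = r + (q - 1) * (r * ell q m)"
  proof -
    have "q ^ m = 1 + (q - 1) * ell q m"
      using q_gt_1 unfolding diff_one_times_ell by simp
    then show ?thesis
      by (simp add: algebra_simps)
  qed
  then have conj_exp: "r * q ^ m = r + (q - 1) + (q ^ e - 1) * w"
    unfolding w q_minus_1_times_l[symmetric] by (simp add: algebra_simps)
  \<comment> \<open>Coprime to both \<open>l\<close> and \<open>q - 1\<close>, the exponent
    \<open>r\<close> is invertible modulo \<open>q ^ e - 1\<close>; hence \<open>v ^ r = 1\<close>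
    will force \<open>v = 1\<close>.\<close>
  have "coprime r l"
    using inv coprime_iff_invertible_nat[of r l] by auto
  then have "coprime r (q ^ e - 1)"
    unfolding q_minus_1_times_l[symmetric] using gcd_eq_1_imp_coprime[OF cop] by simp
  then obtain s where "[r * s = 1] (mod (q ^ e - 1))"
    using cong_solve_coprime_nat[of r "q ^ e - 1"] by auto
  moreover have "1 < q ^ e - 1"
  proof -
    have "l \<le> (q - 1) * l"
      using q_gt_1 by (cases "q - 1") simp_all
    then show ?thesis
      using l_gt_1 unfolding q_minus_1_times_l by simp
  qed
  ultimately obtain w' where w': "r * s = 1 + (q ^ e - 1) * w'"
  proof -
    assume s: "[r * s = 1] (mod (q ^ e - 1))" and gt: "1 < q ^ e - 1"
    have "r * s \<noteq> 0"
      using s gt by (metis cong_def mod_0 mod_less zero_neq_one)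
    then have "1 \<le> r * s"
      by linarith
    then obtain w where "r * s = w * (q ^ e - 1) + 1"
      using s cong_le_nat by blast
    then show thesis
      using that[of w] by (simp add: mult.commute)
  qed
  have root: "v = 1" if "v ^ r = 1" "v \<noteq> 0" for v :: 'a
  proof -
    have "(v ^ r) ^ s = v ^ (1 + (q ^ e - 1) * w')"
      unfolding w'[symmetric] by (rule power_mult[symmetric])
    also have "\<dots> = v"
      using that(2) by (simp add: power_add power_mult power_card_minus_1')
    finally have "(v ^ r) ^ s = v" .
    then show ?thesis
      using that(1) by simp
  qed
  have nonzero: "fpoly q r a x \<noteq> 0" if "x \<noteq> 0" for x
  proof
    assume "fpoly q r a x = 0"
    then have "x ^ (q - 1) + a = 0"
      using that by (simp add: fpoly_def)
    then have "- a = x ^ (q - 1)"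
      by (simp add: add_eq_0_iff2)
    then have "(- a) ^ l = 1"
      using that by (simp add: q_minus_1_times_l[unfolded One_nat_def] power_card_minus_1' flip: power_mult)
    with norm show False
      by simp
  qed
  have "x = y" if eq: "fpoly q r a x = fpoly q r a y" for x y
  proof (cases "x = 0 \<or> y = 0")
    case True
    moreover have "fpoly q r a 0 = 0"
      using r by (simp add: fpoly_def)
    ultimately show ?thesis
      using nonzero eq by metis
  next
    case False
    define v where "v = y / x"
    have y: "y = v * x" and v: "v \<noteq> 0"
      using False by (simp_all add: v_def)
    define z where "z = v ^ r - 1"
    have "x ^ r * (x ^ (q - 1) + a) = x ^ r * (v ^ r * (v ^ (q - 1) * x ^ (q - 1) + a))"
      using eq by (simp add: fpoly_def y power_mult_distrib mult_ac)
    then have "x ^ (q - 1) + a = v ^ r * (v ^ (q - 1) * x ^ (q - 1) + a)"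
      using False by simp
    then have "x ^ (q - 1) + a - a * v ^ r = v ^ r * (v ^ (q - 1) * x ^ (q - 1))"
      by (simp add: algebra_simps)
    then have key: "x ^ (q - 1) * (v ^ (r + (q - 1)) - 1) = - a * z"
      unfolding z_def power_add by (simp add: algebra_simps)
    have "v ^ (r + (q - 1)) = v ^ (r * q ^ m)"
      unfolding conj_exp using v by (simp add: power_add power_mult power_card_minus_1')
    also have "\<dots> = (v ^ r) ^ q ^ m"
      by (rule power_mult)
    also have "\<dots> = (z + 1) ^ q ^ m"
      by (simp add: z_def)
    also have "\<dots> = z ^ q ^ m + 1"
      by (simp add: frobenius_add)
    finally have "x ^ (q - 1) * z ^ q ^ m = - a * z"
      using key by simp
    then have "(x ^ (q - 1) * z ^ q ^ m) ^ l = (- a * z) ^ l"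
      by simp
    then have "x ^ ((q - 1) * l) * (z ^ q ^ m) ^ l = (- a) ^ l * z ^ l"
      by (simp only: power_mult_distrib power_mult)
    then have "z ^ l = (- a) ^ l * z ^ l"
      using False by (simp add: q_minus_1_times_l[unfolded One_nat_def] power_card_minus_1' power_q_power_l)
    then have "z = 0"
      using norm by simp
    then have "v = 1"
      using v root by (simp add: z_def)
    then show ?thesis
      by (simp add: y)
  qed
  then have "inj (fpoly q r a)"
    by (rule injI)
  then show ?thesis
    by (simp add: bij_def finite_UNIV_inj_surj)
qed

section \<open>Necessary conditions on the residue class\<close>

abbreviation L where "L \<equiv> ell q (e - 1)"

text \<open>Collects the data of a permutation polynomial with the residue of \<open>r\<close>
  written as \<open>- q * j\<close>, the form in which the first Hermite sum delivers it. Since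
  \<open>l = 1 + q * L\<close>, the residues \<open>1\<close> and \<open>l - q\<close> are
  \<open>j = L\<close> and \<open>j = 1\<close>.\<close>

definition admissible :: "nat \<Rightarrow> 'a \<Rightarrow> nat \<Rightarrow> bool" where
  "admissible r a j \<longleftrightarrow> 0 < r \<and> a \<noteq> 0 \<and> bij (fpoly q r a) \<and> (- a) ^ l \<noteq> 1 \<and>
     l dvd r + q * j \<and> 1 \<le> j \<and> j \<le> L"

lemma int_l_eq: "int l = 1 + int q * int L"
  using l_eq(1) by simp

text \<open>With \<open>k = L\<close> the binomial row is \<open>q ^ (e - 1) - 1\<close>, where no
  entry vanishes in the field; the residue \<open>i\<close> of \<open>- r * L\<close> must therefore
  lie beyond this row, which leaves the last \<open>L\<close> residues below
  \<open>l\<close>.\<close>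

lemma bij_imp_admissible:
  fixes a :: 'a
  assumes "bij (fpoly q r a)" "0 < r" "a \<noteq> 0"
  obtains j where "admissible r a j"
proof -
  define i where "i = nat (- int (r * L) mod int l)"
  have l_pos: "0 < l"
    using l_gt_1 by simp
  have int_i: "int i = - int (r * L) mod int l"
    using l_pos by (simp add: i_def)
  have i_less: "i < l"
  proof -
    have "int i < int l"
      unfolding int_i using l_pos by simp
    then show ?thesis
      by simp
  qed
  have "int l dvd int (r * L + i)"
    unfolding of_nat_add int_i dvd_eq_mod_eq_0 
    by (simp only: mod_add_right_eq) simp
  then have dvd: "l dvd r * L + i"
    by (simp only: int_dvd_int_iff)
  have "(q - 1) * L = q ^ (e - 1) - 1"
    by (rule diff_one_times_ell)
  moreover have "q ^ (e - 1) - 1 < l"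
    using l_eq(2) l_pos by linarith
  moreover have "0 < L"
    using e_ge_2 by (simp add: ell_pos)
  ultimately have zero: "(of_nat ((q ^ (e - 1) - 1) choose i) :: 'a) = 0"
    using hermite_one_term assms dvd by blast
  have i_ge: "q ^ (e - 1) \<le> i"
  proof (rule ccontr)
    assume "\<not> q ^ (e - 1) \<le> i"
    with zero show False
      by (simp add: of_nat_q_power_minus_1_choose[unfolded One_nat_def])
  qed
  \<comment> \<open>Modulo \<open>l\<close>, \<open>j = r * L\<close> and
    \<open>q * L = - 1\<close>, so \<open>q * j = - r\<close>.\<close>
  define j where "j = l - i"
  have j: "1 \<le> j" "j \<le> L"
    using i_less i_ge l_eq(2) by (simp_all add: j_def)
  obtain c where "r * L + i = l * c"
    using dvd by blast
  then have "int r * int L + (int l - int j) = int l * int c"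
    using i_less by (simp add: j_def flip: of_nat_mult of_nat_add)
  then have "int j = int r * int L + int l - int l * int c"
    by simp
  then have "int r + int q * int j = int r + int q * (int r * int L + int l - int l * int c)"
    by (simp only:)
  also have "\<dots> = int r * (1 + int q * int L) + int l * (int q - int q * int c)"
    by (simp add: algebra_simps)
  finally have "int r + int q * int j = int l * (int r + int q - int q * int c)"
    unfolding int_l_eq[symmetric] by (simp add: algebra_simps)
  then have "int l dvd int (r + q * j)"
    by simp
  then have "l dvd r + q * j"
    by (simp only: int_dvd_int_iff)
  with assms j bij_imp_norm_neq_1[OF assms(1,2)] show thesis
    by (intro that[of j]) (simp add: admissible_def)
qed

text \<open>Substituting \<open>1 / x\<close> exchanges \<open>r\<close> with \<open>- r - (q - 1)\<close> and \<open>a\<close> with \<open>1 / a\<close>.\<close>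

lemma admissible_mirror:
  assumes "admissible r a j"
  obtains r' a' where "admissible r' a' (L + 1 - j)"
proof -
  have r: "0 < r" and a: "a \<noteq> 0" and bij: "bij (fpoly q r a)" and norm: "(- a) ^ l \<noteq> 1"
    and dvd: "l dvd r + q * j" and j: "1 \<le> j" "j \<le> L"
    using assms by (auto simp: admissible_def)
  \<comment> \<open>The exponent is \<open>- (r + q - 1)\<close> modulo \<open>q ^ e - 1\<close>;
    the factor \<open>r + q\<close> keeps the truncated difference positive.\<close>
  define r' where "r' = (q ^ e - 1) * (r + q) - (r + (q - 1))"
  have "1 * (r + q) \<le> (q ^ e - 1) * (r + q)"
    using q_power_e_gt_1 by (intro mult_right_mono) simp_all
  then have "r + (q - 1) < (q ^ e - 1) * (r + q)"
    by (rule less_le_trans[rotated]) (use q_gt_1 in simp)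
  then have r'_add: "r' + (r + (q - 1)) = (q ^ e - 1) * (r + q)" and r': "0 < r'"
    unfolding r'_def by simp_all
  have "fpoly q r' (inverse a) x = inverse a * fpoly q r a (inverse x)" for x
  proof (cases "x = 0")
    case False
    have "x ^ r' * (x ^ r * x ^ (q - 1)) = (x ^ (q ^ e - 1)) ^ (r + q)"
      by (simp only: r'_add flip: power_add power_mult)
    then have "x ^ r' * x ^ r * x ^ (q - 1) = 1"
      using False by (simp add: power_card_minus_1' mult.assoc)
    then have "x ^ r' = inverse x ^ r * inverse x ^ (q - 1)"
      using False by (simp add: field_simps)
    then show ?thesis
      using False a by (simp add: fpoly_def field_simps)
  qed (use r r' in \<open>simp add: fpoly_def power_0_left\<close>)
  then have eq: "fpoly q r' (inverse a) = (\<lambda>y. inverse a * y) \<circ> (fpoly q r a \<circ> inverse)"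
    by auto
  have "bij (\<lambda>y. inverse a * y)"
    by (rule bij_betw_byWitness[where f' = "\<lambda>y. a * y"]) (use a in auto)
  moreover have "bij (inverse :: 'a \<Rightarrow> 'a)"
    by (rule bij_betw_byWitness[where f' = inverse]) auto
  ultimately have bij': "bij (fpoly q r' (inverse a))"
    unfolding eq using bij by (intro bij_comp)
  have r'_int: "int r' + int r + int q - 1 = int (q ^ e - 1) * (int r + int q)"
  proof -
    have "int (r' + (r + (q - 1))) = int ((q ^ e - 1) * (r + q))"
      by (simp only: r'_add)
    then show ?thesis
      using q_gt_1 by (simp add: of_nat_diff)
  qed
  have Q: "int (q ^ e - 1) = (int q - 1) * int l"
    unfolding q_minus_1_times_l[symmetric] using q_gt_1 by (simp add: of_nat_diff)
  obtain c where "r + q * j = l * c"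
    using dvd by blast
  then have "int r + int q * int j = int l * int c"
    by (simp flip: of_nat_mult of_nat_add)
  \<comment> \<open>Each of the three groups on the right is a multiple of \<open>l\<close>.\<close>
  moreover have "int r' + int q * (int L + 1 - int j) =
      (int r' + int r + int q - 1) + (1 + int q * int L) - (int r + int q * int j)"
    by (simp add: algebra_simps)
  ultimately have "int r' + int q * (int L + 1 - int j) =
      int l * ((int q - 1) * (int r + int q) - int c + 1)"
    unfolding r'_int Q int_l_eq[symmetric] by (simp add: algebra_simps)
  moreover have "int (r' + q * (L + 1 - j)) = int r' + int q * (int L + 1 - int j)"
    using j(2) by (simp add: of_nat_diff)
  ultimately have "int l dvd int (r' + q * (L + 1 - j))"
    by (simp only: dvd_triv_left)
  then have "l dvd r' + q * (L + 1 - j)"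
    by (simp only: int_dvd_int_iff)
  moreover have "(- inverse a) ^ l \<noteq> 1"
    using norm by (simp add: power_inverse flip: inverse_minus_eq)
  moreover have "1 \<le> L + 1 - j" "L + 1 - j \<le> L"
    using j by linarith+
  ultimately show thesis
    using that[of r' "inverse a"] bij' r' a by (simp add: admissible_def)
qed

text \<open>As \<open>r = - q * j\<close> modulo \<open>l\<close>, the class of
  \<open>- r * k\<close> is that of \<open>q * j * k\<close>. The witness \<open>w\<close> turns the
  congruence into an integer identity, which the later cases verify by expansion.\<close>

lemma admissible_imp_dvd:
  assumes "admissible r a j" and i: "int i = int q * int j * int k + int l * w"
  shows "l dvd r * k + i"
proof -
  obtain c where "r + q * j = l * c"
    using assms(1) by (auto simp: admissible_def)
  then have "int r + int q * int j = int l * int c"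
    by (simp flip: of_nat_mult of_nat_add)
  moreover have "int (r * k + i) = (int r + int q * int j) * int k + int l * w"
    by (simp add: i algebra_simps)
  ultimately have "int (r * k + i) = int l * (int c * int k + w)"
    by (simp add: algebra_simps)
  then show ?thesis
    by (metis dvd_triv_left int_dvd_int_iff)
qed

lemma admissible_imp_choose_eq_0:
  assumes "admissible r a j" "0 < k" "(q - 1) * k = S" "S < l"
    and i: "int i = int q * int j * int k + int l * w"
  shows "(of_nat (S choose i) :: 'a) = 0"
  using admissible_imp_dvd[OF assms(1) i] hermite_one_term assms by (auto simp: admissible_def)

lemma admissible_imp_two_terms:
  assumes "admissible r a j" "0 < k" "k < l" "(q - 1) * k = S" "S < 2 * l" "i < l"
    and i: "int i = int q * int j * int k + int l * w"
  shows "of_nat (S choose i) * a ^ (S - i) + of_nat (S choose (i + l)) * a ^ (S - (i + l)) = 0"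
  using admissible_imp_dvd[OF assms(1) i] hermite_two_terms assms by (auto simp: admissible_def)

section \<open>Restrictions on \<open>j\<close> from special choices of \<open>k\<close>\<close>

lemma choose_digit:
  assumes "d < q" "u < q"
  shows "(of_nat ((d + q * D) choose (u + q * U)) :: 'a) = of_nat (d choose u) * of_nat (D choose U)"
  using lucas_step[of d 1 u D U] assms by simp

lemma of_nat_l: "(of_nat l :: 'a) = 1"
  unfolding l_eq(1) by simp

lemma of_nat_mod_q: "(of_nat (n mod q) :: 'a) = of_nat n"
proof -
  have "(of_nat n :: 'a) = of_nat (n mod q + q * (n div q))"
    by simp
  also have "\<dots> = of_nat (n mod q)"
    unfolding of_nat_add of_nat_mult by simp
  finally show ?thesis ..
qed

lemma two_neq_0:
  assumes "odd q"
  shows "(2 :: 'a) \<noteq> 0"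
proof
  assume "(2 :: 'a) = 0"
  then have "(of_nat 2 :: 'a) = 0"
    by simp
  then have "CHAR('a) dvd 2"
    by (simp only: of_nat_eq_0_iff_char_dvd)
  then have "CHAR('a) = 2"
    using prime_CHAR primes_dvd_imp_eq two_is_prime_nat by blast
  then show False
    using CHAR_dvd_q assms by simp
qed

lemma two_eq_0:
  assumes "even q"
  shows "(2 :: 'a) = 0"
proof -
  obtain n where "0 < n" "q = CHAR('a) ^ n"
    using q_eq_CHAR_power by blast
  then have "even CHAR('a)"
    using assms by simp
  then have "2 = CHAR('a)"
    by (rule primes_dvd_imp_eq[OF two_is_prime_nat prime_CHAR])
  then have "CHAR('a) dvd 2"
    by (metis dvd_refl)
  then have "(of_nat 2 :: 'a) = 0"
    by (rule of_nat_eq_0_iff_char_dvd[THEN iffD2])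
  then show ?thesis
    by (simp only: of_nat_numeral)
qed

text \<open>In base \<open>q ^ m\<close> the upper entry has the digits \<open>q ^ m - 1\<close> and
  \<open>1\<close>, and neither digit admits a vanishing coefficient.\<close>

lemma of_nat_double_q_power_minus_1_choose:
  assumes "u < 2 * q ^ m"
  shows "(of_nat ((2 * q ^ m - 1) choose u) :: 'a) \<noteq> 0"
proof -
  have Z: "0 < q ^ m"
    using q_gt_1 by simp
  have top: "u div q ^ m < 2"
    using assms by (simp add: less_mult_imp_div_less)
  have eq: "2 * q ^ m - 1 = (q ^ m - 1) + q ^ m * 1" "u = u mod q ^ m + q ^ m * (u div q ^ m)"
    using Z by simp_all
  have "(of_nat ((2 * q ^ m - 1) choose u) :: 'a) =
      of_nat ((q ^ m - 1) choose (u mod q ^ m)) * of_nat (1 choose (u div q ^ m))"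
    by (subst eq(1), subst eq(2), rule lucas_step) (use Z in simp_all)
  moreover have "u div q ^ m = 0 \<or> u div q ^ m = 1"
    using top by linarith
  ultimately show ?thesis
    using Z of_nat_q_power_minus_1_choose[of "u mod q ^ m" m] by auto
qed

lemma q_power_e: "q ^ (e - 1) = q * q ^ (e - 2)"
proof -
  have "e - 1 = Suc (e - 2)"
    using e_ge_2 by simp
  then show ?thesis
    by simp
qed

text \<open>Take \<open>k = 2 * L\<close>. The row is \<open>2 * q ^ (e - 1) - 2\<close>, with
  lowest digit \<open>q - 2\<close>, and the only index is \<open>l - 2 * j\<close>. The higher
  digits contribute a nonzero factor, so the lowest digit of the index must be -1 in the field,
  which gives \<open>2 * j = 2\<close> there.\<close>

lemma admissible_of_nat_eq_1:
  assumes adm: "admissible r a j" and "odd q" and j: "2 * j \<le> L + 1"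
  shows "(of_nat j :: 'a) = 1"
proof -
  have q: "3 \<le> q"
    using q_gt_1 \<open>odd q\<close> by (cases "q = 2") auto
  have L: "0 < L"
    using e_ge_2 by (simp add: ell_pos)
  have a: "a \<noteq> 0" and j1: "1 \<le> j"
    using adm by (auto simp: admissible_def)
  define Z where "Z = q ^ (e - 2)"
  have Z: "0 < Z"
    using q_gt_1 by (simp add: Z_def)
  have l: "l = L + q * Z"
    using l_eq(2) q_power_e by (simp add: Z_def)
  define S where "S = 2 * (q * Z) - 2"
  have S: "(q - 1) * (2 * L) = S"
  proof -
    have "(q - 1) * (2 * L) = 2 * ((q - 1) * L)"
      by simp
    also have "\<dots> = S"
      unfolding diff_one_times_ell q_power_e S_def Z_def by simp
    finally show ?thesis .
  qed
  have "2 * L < l"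
  proof -
    have "3 * L \<le> q * L"
      using q by (rule mult_right_mono) simp
    then show ?thesis
      using l_eq(1) L by linarith
  qed
  define i where "i = l - 2 * j"
  have i: "i < l" "i + 2 * j = l"
    using j j1 l Z L q_gt_1 \<open>2 * L < l\<close> by (simp_all add: i_def)
  have int_i: "int i = int l - 2 * int j"
    using i(2) by simp
  have cong: "int i = int q * int j * int (2 * L) + int l * (1 - 2 * int j)"
    unfolding int_i int_l_eq by (simp add: algebra_simps)
  \<comment> \<open>The bound on \<open>j\<close> pushes \<open>i + l\<close> beyond
    \<open>S\<close>, so one term remains.\<close>
  have S_less: "S < i + l"
    using l j i(2) L Z unfolding S_def by linarith
  have "of_nat (S choose i) * a ^ (S - i) = 0"
    using admissible_imp_two_terms[OF adm _ \<open>2 * L < l\<close> S _ i(1) cong] S_less i(1) L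
    by (simp add: binomial_eq_0)
  then have "(of_nat (S choose i) :: 'a) = 0"
    using a by simp
  moreover have "S = (q - 2) + q * (2 * Z - 1)"
  proof -
    have "q * (2 * Z - 1) = 2 * (q * Z) - q"
      by (simp add: diff_mult_distrib2)
    moreover have "q \<le> q * Z"
      using Z by simp
    ultimately show ?thesis
      unfolding S_def using q by linarith
  qed
  ultimately have "(of_nat (((q - 2) + q * (2 * Z - 1)) choose (i mod q + q * (i div q))) :: 'a) = 0"
    by simp
  then have "(of_nat ((q - 2) choose (i mod q)) :: 'a) * of_nat ((2 * Z - 1) choose (i div q)) = 0"
    using q_gt_1 by (subst (asm) choose_digit) simp_all
  moreover have "i div q < 2 * Z"
  proof -
    have "i < (2 * Z) * q"
      using i j l S_less L j1 S_def Z \<open>2 * L < l\<close> by (simp add: mult.commute mult.left_commute)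
    then show ?thesis
      by (rule less_mult_imp_div_less)
  qed
  ultimately have "(of_nat ((q - 2) choose (i mod q)) :: 'a) = 0"
    using of_nat_double_q_power_minus_1_choose[of "i div q" "e - 2"] by (simp add: Z_def)
  then have "(of_nat (i mod q) + 1 :: 'a) = 0"
    using q_gt_1 by (subst (asm) of_nat_q_minus_2_choose) (simp_all add: add.commute)
  then have "(of_nat i + 1 :: 'a) = 0"
    by (simp add: of_nat_mod_q)
  moreover have "(of_nat i + 2 * of_nat j :: 'a) = 1"
    using arg_cong[OF i(2), of "of_nat :: nat \<Rightarrow> 'a"] of_nat_l by simp
  moreover have "(2 * of_nat j :: 'a) = (of_nat i + 2 * of_nat j) - (of_nat i + 1) + 1"
    by simp
  ultimately have "(2 * of_nat j :: 'a) = 2 * 1"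
    by simp
  then show ?thesis
    using mult_left_cancel[OF two_neq_0[OF \<open>odd q\<close>], of "of_nat j" 1] by blast
qed

lemma q_plus_1_coprime_q: "coprime (q + 1) q"
  by (simp add: coprime_commute)

text \<open>Here \<open>q + 1\<close> divides \<open>l\<close> with quotient \<open>k\<close>, and
  the index is \<open>u * k\<close> with \<open>u = q * j mod (q + 1)\<close>. Only
  \<open>u = q\<close> lies beyond the row \<open>(q - 1) * k\<close>, and cancelling
  \<open>q\<close> gives the congruence for \<open>j\<close>.\<close>

lemma admissible_imp_cong_1_mod_q_plus_1:
  assumes adm: "admissible r a j" and k: "0 < k" "l = (q + 1) * k"
    and choose: "\<And>u. u < q \<Longrightarrow> (of_nat (((q - 1) * k) choose (u * k)) :: 'a) \<noteq> 0"
  obtains c where "j = 1 + (q + 1) * c"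
proof -
  define u where "u = q * j mod (q + 1)"
  have "(q - 1) * k < l"
    unfolding k(2) using k(1) by (intro mult_strict_right_mono) simp_all
  moreover have "int (u * k) = int q * int j * int k + int l * (- int (q * j div (q + 1)))"
  proof -
    define v where "v = q * j div (q + 1)"
    have "q * j = u + (q + 1) * v"
      by (simp only: u_def v_def mod_mult_div_eq)
    then have "int q * int j = int u + (int q + 1) * int v"
      by (metis of_nat_add of_nat_mult of_nat_1)
    then have "int q * int j * int k = (int u + (int q + 1) * int v) * int k"
      by (simp only:)
    then show ?thesis
      unfolding k(2) v_def[symmetric] by (simp add: algebra_simps)
  qed
  ultimately have "(of_nat (((q - 1) * k) choose (u * k)) :: 'a) = 0"
    using admissible_imp_choose_eq_0[OF adm k(1) refl] by blast
  then have "\<not> u < q"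
    using choose by blast
  moreover have "u < q + 1"
    by (simp add: u_def)
  ultimately have "u = q"
    by linarith
  then have "q * j mod (q + 1) = q mod (q + 1)"
    by (simp add: u_def)
  then have "[q * j = q * 1] (mod (q + 1))"
    by (simp add: cong_def)
  then have "[j = 1] (mod (q + 1))"
    using q_plus_1_coprime_q by (simp only: cong_mult_lcancel_nat coprime_commute)
  moreover have "1 \<le> j"
    using adm by (simp add: admissible_def)
  ultimately obtain c where "j = c * (q + 1) + 1"
    using cong_le_nat by blast
  then show thesis
    using that[of c] by (simp add: mult.commute)
qed

text \<open>Take \<open>k = L - 1\<close>. The index \<open>l - (q + 1) * j\<close> and the row
  \<open>q * (q ^ (e - 2) - 1)\<close> are both divisible by \<open>q\<close>, so the coefficient is
  a sign as soon as the index is below \<open>q ^ (e - 1)\<close>, that is, when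
  \<open>(q + 1) * j > L\<close>.\<close>

lemma admissible_imp_q_plus_1_times_le:
  assumes adm: "admissible r a j" and e: "3 \<le> e" and j: "2 * j \<le> L + 1" "j = 1 + q * c"
  shows "(q + 1) * j \<le> L"
proof (rule ccontr)
  assume less: "\<not> (q + 1) * j \<le> L"
  have L: "L = 1 + q * ell q (e - 2)"
    using e ell_Suc'[of q "e - 2"] by (simp add: Suc_diff_le numeral_2_eq_2 Suc_diff_Suc)
  have Z: "0 < q ^ (e - 2)"
    using q_gt_1 by simp
  define k where "k = q * ell q (e - 2)"
  have k: "0 < k" "L = 1 + k"
    using e q_gt_1 L by (simp_all add: k_def ell_pos)
  define S where "S = q * (q ^ (e - 2) - 1)"
  have "(q - 1) * k = (q - 1) * L - (q - 1)"
    unfolding k(2) by (simp add: distrib_left)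
  then have S: "(q - 1) * k = S"
    unfolding diff_one_times_ell q_power_e S_def using q_gt_1 by (simp add: diff_mult_distrib2)
  \<comment> \<open>The restriction of \<open>j\<close> to the lower half keeps the index from
    becoming negative.\<close>
  have le_l: "(q + 1) * j \<le> l"
  proof -
    have "(q + 1) * (2 * j) \<le> (q + 1) * (L + 1)"
      using j(1) by (intro mult_left_mono) simp_all
    also have "\<dots> = l + L + q"
      unfolding l_eq(1) by (simp add: algebra_simps)
    also have "\<dots> \<le> l + l"
      using l_eq(2) q_power_e Z by simp
    finally show ?thesis
      by simp
  qed
  define i where "i = l - (q + 1) * j"
  have int_i: "int i = int l - (int q + 1) * int j"
    unfolding i_def using le_l by (simp add: of_nat_diff algebra_simps)
  have "int i = int q * int j * int k + int l * (1 - int j)"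
    unfolding int_i int_l_eq k(2) by (simp add: algebra_simps)
  moreover have "S < l"
    unfolding S_def l_eq(2) q_power_e using k(2) by (simp add: diff_mult_distrib2)
  ultimately have zero: "(of_nat (S choose i) :: 'a) = 0"
    using admissible_imp_choose_eq_0[OF adm k(1) S] by blast
  have i_less: "i < q * q ^ (e - 2)"
    unfolding i_def using less le_l l_eq(2) q_power_e by linarith
  have "int i = int q * (int L - 1 - (int q + 1) * int c)"
    unfolding int_i int_l_eq j(2) by (simp add: algebra_simps)
  then have "q dvd i"
    by (metis dvd_triv_left int_dvd_int_iff)
  then obtain U where U: "i = q * U"
    by blast
  have "(of_nat ((0 + q * (q ^ (e - 2) - 1)) choose (0 + q * U)) :: 'a) =
      of_nat (0 choose 0) * of_nat ((q ^ (e - 2) - 1) choose U)"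
    using q_gt_1 by (intro choose_digit) simp_all
  moreover have "U < q ^ (e - 2)"
    using i_less q_gt_1 by (simp add: U)
  ultimately show False
    using zero by (simp add: S_def U of_nat_q_power_minus_1_choose[unfolded One_nat_def])
qed

text \<open>The upper entry is \<open>(q - 1) * (L + q ^ (e - 2))\<close> for
  \<open>m = e - 2\<close>. Of its digits \<open>q ^ m - 1\<close>, \<open>q - 2\<close> and
  \<open>1\<close> only the middle one can produce a zero coefficient.\<close>

lemma of_nat_two_terms_choose:
  assumes "low < q ^ m" "mid < q" "hi \<le> 1"
  shows "(of_nat (((q ^ m - 1) + q ^ m * ((q - 2) + q * 1)) choose (low + q ^ m * (mid + q * hi))) :: 'a)
    = (- 1) ^ low * ((- 1) ^ mid * of_nat (mid + 1))"
proof -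
  have "(of_nat (1 choose hi) :: 'a) = 1"
    using assms(3) by (cases hi) simp_all
  then have "(of_nat (((q - 2) + q * 1) choose (mid + q * hi)) :: 'a) = (- 1) ^ mid * of_nat (mid + 1)"
    using assms q_gt_1 by (subst choose_digit) (simp_all only: of_nat_q_minus_2_choose, simp_all)
  then show ?thesis
    using assms q_gt_1 by (subst lucas_step) (simp_all only: of_nat_q_power_minus_1_choose)
qed

text \<open>With \<open>k = L + q ^ (e - 2)\<close> at most two terms of the Hermite sum survive.
  In odd characteristic \<open>c\<close> vanishes in the field, and one of the two coefficients is zero; the
  same holds in characteristic 2, except for \<open>2 * c = q\<close>, where the sum is a multiple of
  \<open>a ^ l + 1\<close>.\<close>

lemma not_admissible_between:
  assumes adm: "admissible r a j" and e: "3 \<le> e"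
    and j: "j = 1 + c * ell q (e - 2)" and c: "1 \<le> c" "2 * c \<le> q"
  shows False
proof -
  define X Y where "X = q ^ (e - 3)" and "Y = ell q (e - 3)"
  have a: "a \<noteq> 0" and norm: "(- a) ^ l \<noteq> 1"
    using adm by (auto simp: admissible_def)
  have e_Suc: "e - 1 = Suc (e - 2)" "e - 2 = Suc (e - 3)" "e = Suc (e - 1)"
    using e by simp_all
  have X: "X = 1 + (q - 1) * Y"
    unfolding X_def Y_def diff_one_times_ell using q_gt_1 by simp
  have Z: "q ^ (e - 2) = q * X"
    unfolding X_def e_Suc(2) by simp
  have ell2: "ell q (e - 2) = X + Y" "ell q (e - 2) = 1 + q * Y"
    unfolding X_def Y_def e_Suc(2) using ell_Suc[of q "e - 3"] ell_Suc'[of q "e - 3"] by simp_all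
  have L: "L = X + Y + q * X"
    unfolding e_Suc(1) ell_Suc Z ell2(1) by simp
  have l: "l = X + Y + q * X + q * (q * X)"
    unfolding l_eq(2) q_power_e Z L by simp
  have L': "L = 1 + q * (X + Y)"
    unfolding e_Suc(1) ell_Suc' ell2(1) by simp
  have l': "l = 1 + q + q * (q * (X + Y))"
    unfolding l_eq(1) L' by (simp add: algebra_simps)
  \<comment> \<open>For \<open>q = 2\<close> every nonzero element has norm one, so the norm
    condition cannot hold.\<close>
  have q: "3 \<le> q"
  proof (rule ccontr)
    assume "\<not> 3 \<le> q"
    then have "q = 2"
      using q_gt_1 by simp
    then have "l = q ^ e - 1"
      using q_minus_1_times_l by simp
    then show False
      using norm power_card_minus_1[of "- a"] a by simp
  qed
  have X_pos: "1 \<le> X"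
    using X by simp
  have Xq: "X \<le> q * X" "3 * X \<le> q * X"
    using q by (simp_all add: mult_right_mono)
  have qX: "3 * (q * X) \<le> q * (q * X)"
    using q by (intro mult_right_mono) simp_all
  define k where "k = L + q * X"
  define D where "D = (q * X - 1) + q * X * ((q - 2) + q * 1)"
  have D: "D + 1 + q * X = 2 * (q * (q * X))"
  proof -
    have "q * X * ((q - 2) + q * 1) + 2 * (q * X) = q * X * ((q - 2) + 2 + q)"
      by (simp only: distrib_left)
    also have "(q - 2) + 2 + q = q * 2"
      using q by simp
    also have "q * X * (q * 2) = 2 * (q * (q * X))"
      by simp
    finally have "q * X * ((q - 2) + q * 1) + 2 * (q * X) = 2 * (q * (q * X))" .
    then show ?thesis
      unfolding D_def using X_pos Xq by (metis add.assoc add.commute le_add_diff_inverse2 mult_2 order_trans)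
  qed
  have S: "(q - 1) * k = D"
  proof -
    have "(q - 1) * k = ((q - 1) * L) + (q - 1) * (q * X)"
      by (simp add: k_def distrib_left)
    also have "(q - 1) * L = q * (q * X) - 1"
      unfolding diff_one_times_ell q_power_e Z ..
    also have "(q - 1) * (q * X) = q * (q * X) - q * X"
      by (simp add: diff_mult_distrib)
    finally show ?thesis
      using D qX X_pos Xq by linarith
  qed
  have k: "0 < k" "k < l"
    unfolding k_def l L using X_pos Xq qX by linarith+
  have D_less: "D < 2 * l"
    using D l by linarith
  have cY: "c * Y \<le> X - 1"
  proof -
    have "c * Y \<le> (q - 1) * Y"
      using c by (intro mult_right_mono) simp_all
    then show ?thesis
      using X by simp
  qed
  have cX: "2 * (c * X) \<le> q * X"
    using mult_right_mono[OF c(2), of X] by (simp add: mult.assoc)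
  have cX1: "X \<le> c * X" "Y \<le> c * Y"
    using c(1) by simp_all
  \<comment> \<open>Modulo \<open>l\<close>, \<open>q * k\<close> is \<open>q ^ (e - 1) - 1\<close>;
    multiplying by \<open>j\<close> and removing \<open>c * X\<close> copies of \<open>l\<close>
    leaves the index assumed here.\<close>
  have cong: "int i = int q * int j * int k + int l * (- int j - int c * int X)"
    if "int i = int q * (int q * int X) - 1 - int c * (int q * int X + 2 * int X + int Y)" for i
  proof -
    have "int q * int k = int l - 1 + int q * (int q * int X)"
      unfolding k_def int_l_eq by (simp add: algebra_simps)
    then have "int q * int j * int k = int j * (int l - 1 + int q * (int q * int X))"
      by (simp add: mult_ac)
    moreover have "int j = 1 + int c * (int X + int Y)"
      using j ell2(1) by simp
    moreover have "int l = 1 + int q + int q * (int q * (int X + int Y))"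
      using l' by simp
    ultimately show ?thesis
      unfolding that by (simp add: algebra_simps)
  qed
  have odd_c: "(of_nat c :: 'a) = 0" if "odd q"
  proof -
    have "2 * j \<le> L + 1"
    proof -
      have "(2 * c) * (X + Y) \<le> q * (X + Y)"
        using c(2) by (rule mult_right_mono) simp
      then show ?thesis
        unfolding j ell2(1) L' by simp
    qed
    then have "(of_nat j :: 'a) = 1"
      using admissible_of_nat_eq_1[OF adm that] by blast
    then show ?thesis
      unfolding j ell2(2) by simp
  qed
  have c_01: "(of_nat c :: 'a) = 0 \<or> (of_nat c :: 'a) = 1"
  proof (cases "odd q")
    case False
    then have "(2 :: 'a) = 0"
      by (simp add: two_eq_0)
    moreover have "(of_nat c :: 'a) = of_nat (c mod 2) + 2 * of_nat (c div 2)"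
      by (metis mod_mult_div_eq of_nat_add of_nat_mult of_nat_numeral)
    ultimately have "(of_nat c :: 'a) = of_nat (c mod 2)"
      by simp
    moreover have "c mod 2 = 0 \<or> c mod 2 = 1"
      by linarith
    ultimately show ?thesis
      by auto
  qed (simp add: odd_c)
  have c_dist: "c * (2 * X + Y) = 2 * (c * X) + c * Y"
    by (simp add: distrib_left)
  \<comment> \<open>The lowest digit of \<open>i + l\<close> in base \<open>q * X\<close>. It is the
    same in both cases below, a carry in the second case making up for the different
    \<open>low0\<close>.\<close>
  define low1 where "low1 = q * X + X + Y - 1 - c * (2 * X + Y)"
  have low1: "low1 + 1 + 2 * (c * X) + c * Y = q * X + X + Y" "low1 < q * X"
    unfolding low1_def c_dist using cX cX1 cY X_pos by linarith+
  have q_c: "(of_nat (q - c) :: 'a) = - of_nat c"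
    using c by (simp add: of_nat_diff)
  show False
  proof (cases "2 * c < q")
    case True
    define low0 where "low0 = q * X - 1 - c * (2 * X + Y)"
    have "2 * c + 1 \<le> q"
      using True by simp
    then have "(2 * c + 1) * X \<le> q * X"
      by (rule mult_right_mono) simp
    then have "2 * (c * X) + X \<le> q * X"
      by (simp add: distrib_right)
    then have low0: "low0 + 1 + 2 * (c * X) + c * Y = q * X" "low0 < q * X"
      unfolding low0_def c_dist using cY X_pos cX1 by linarith+
    define i where "i = low0 + q * X * ((q - c - 1) + q * 0)"
    have mid: "q * X * (q - c - 1) + q * X * c + q * X = q * (q * X)"
    proof -
      have "q * X * ((q - c - 1) + c + 1) = q * (q * X)"
        using True by simp
      then show ?thesis
        by (simp only: distrib_left mult_1_right)
    qed
    have i_eq: "i + 1 + 2 * (c * X) + c * Y + q * X * c = q * (q * X)"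
      unfolding i_def using mid low0 by simp
    have i_l: "i + l = low1 + q * X * ((q - c) + q * 1)"
    proof -
      have "q * X * ((q - c) + q * 1) = q * X * (q - c - 1) + q * X + q * (q * X)"
      proof -
        have "(q - c) + q * 1 = (q - c - 1) + 1 + q"
          using True by simp
        then show ?thesis
          by (simp only: distrib_left mult_1_right mult.commute)
      qed
      then show ?thesis
        unfolding l using low1(1) mid i_eq by linarith
    qed
    have "i < l"
      unfolding l using i_eq X_pos by linarith
    have "int i = int q * (int q * int X) - 1 - int c * (int q * int X + 2 * int X + int Y)"
      using arg_cong[OF i_eq, of int] by (simp add: algebra_simps)
    from admissible_imp_two_terms[OF adm k S D_less \<open>i < l\<close> cong[OF this]]
    have "of_nat (D choose i) * a ^ (D - i) + of_nat (D choose (i + l)) * a ^ (D - (i + l)) = 0" .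
    moreover have "(of_nat (D choose i) :: 'a) = (- 1) ^ low0 * ((- 1) ^ (q - c - 1) * of_nat (q - c - 1 + 1))"
      unfolding D_def i_def Z[symmetric]
      by (rule of_nat_two_terms_choose) (use low0 Z c q in simp_all)
    moreover have "(of_nat (D choose (i + l)) :: 'a) = (- 1) ^ low1 * ((- 1) ^ (q - c) * of_nat (q - c + 1))"
      unfolding D_def i_l Z[symmetric]
      by (rule of_nat_two_terms_choose) (use low1 Z c q in simp_all)
    moreover have "q - c - 1 + 1 = q - c"
      using True by simp
    ultimately have "(- 1) ^ low0 * ((- 1) ^ (q - c - 1) * - of_nat c) * a ^ (D - i) +
        (- 1) ^ low1 * ((- 1) ^ (q - c) * (- of_nat c + 1)) * a ^ (D - (i + l)) = 0"
      by (simp only: of_nat_add q_c of_nat_1)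
    \<comment> \<open>Up to sign the coefficients are \<open>c\<close> and \<open>1 - c\<close>;
      with \<open>c\<close> equal to 0 or 1 in the field exactly one survives.\<close>
    then show False
      using c_01 a by auto
  next
    case False
    then have q2c: "q = 2 * c"
      using c by simp
    then have "even q"
      by simp
    have c2: "2 \<le> c"
      using q q2c by simp
    have two: "(2 :: 'a) = 0"
      using \<open>even q\<close> by (rule two_eq_0)
    have minus: "- x = x" for x :: 'a
    proof -
      have "x + x = 2 * x"
        by simp
      then show ?thesis
        using two by (simp add: neg_eq_iff_add_eq_0)
    qed
    \<comment> \<open>A power of two above 2 has an even half.\<close>
    have c0: "(of_nat c :: 'a) = 0"
    proof -
      obtain n where n: "0 < n" "q = CHAR('a) ^ n"
        using q_eq_CHAR_power by blast
      have "even CHAR('a)"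
        using n \<open>even q\<close> by simp
      then have "2 = CHAR('a)"
        by (rule primes_dvd_imp_eq[OF two_is_prime_nat prime_CHAR])
      with n q2c have "2 * c = 2 ^ n"
        by metis
      then have "c = 2 ^ (n - 1)"
        using n(1) by (cases n) simp_all
      with c2 have "even c"
        by (cases "n - 1") simp_all
      then show ?thesis
        using two by (auto elim!: evenE)
    qed
    \<comment> \<open>As \<open>2 * (c * X) = q * X\<close>, the lowest digit would be
      \<open>- 1 - c * Y\<close>; borrowing from the middle digit lowers that one to
      \<open>q - c - 2\<close>.\<close>
    define low0 where "low0 = q * X - 1 - c * Y"
    have low0: "low0 + 1 + c * Y = q * X" "low0 < q * X"
      unfolding low0_def using cY X_pos Xq by linarith+
    define i where "i = low0 + q * X * ((q - c - 2) + q * 0)"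
    have mid: "q * X * (q - c - 2) + q * X * c + 2 * (q * X) = q * (q * X)"
    proof -
      have "(q - c - 2) + c + 2 = q"
        using c2 q2c by linarith
      then have "q * X * ((q - c - 2) + c + 2) = q * (q * X)"
        by (simp only: mult.commute)
      then show ?thesis
        by (simp only: distrib_left mult.commute)
    qed
    have cX2: "2 * (c * X) = q * X"
      unfolding q2c by simp
    have i_eq: "i + 1 + 2 * (c * X) + c * Y + q * X * c = q * (q * X)"
    proof -
      have "i = low0 + q * X * (q - c - 2)"
        by (simp add: i_def)
      then show ?thesis
        using mid low0 cX2 by linarith
    qed
    have i_l: "i + l = low1 + q * X * ((q - c) + q * 1)"
    proof -
      have "(q - c) + q * 1 = (q - c - 2) + 2 + q"
        using c2 q2c by linarith
      then have "q * X * ((q - c) + q * 1) = q * X * ((q - c - 2) + 2 + q)"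
        by (simp only:)
      also have "\<dots> = q * X * (q - c - 2) + 2 * (q * X) + q * (q * X)"
        by (simp only: distrib_left mult.commute)
      finally show ?thesis
        unfolding l using low1(1) mid i_eq by linarith
    qed
    have "i < l"
      unfolding l using i_eq X_pos by linarith
    have "int i = int q * (int q * int X) - 1 - int c * (int q * int X + 2 * int X + int Y)"
      using arg_cong[OF i_eq, of int] by (simp add: algebra_simps)
    from admissible_imp_two_terms[OF adm k S D_less \<open>i < l\<close> cong[OF this]]
    have eq: "of_nat (D choose i) * a ^ (D - i) + of_nat (D choose (i + l)) * a ^ (D - (i + l)) = 0" .
    have "(of_nat (D choose i) :: 'a) = (- 1) ^ low0 * ((- 1) ^ (q - c - 2) * of_nat (q - c - 2 + 1))"
      unfolding D_def i_def Z[symmetric]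
      by (rule of_nat_two_terms_choose) (use low0 Z c q in simp_all)
    moreover have "(of_nat (q - c - 2 + 1) :: 'a) = 1"
    proof -
      have "q - c - 2 + 1 + 1 = c"
        using c2 q2c by simp
      then have "(of_nat (q - c - 2 + 1) + 1 :: 'a) = 0"
        using c0 by (metis of_nat_1 of_nat_add)
      then show ?thesis
        using minus[of 1] by (simp add: add_eq_0_iff2)
    qed
    ultimately have T0: "(of_nat (D choose i) :: 'a) = 1"
      by (simp add: minus)
    have "(of_nat (D choose (i + l)) :: 'a) = (- 1) ^ low1 * ((- 1) ^ (q - c) * of_nat (q - c + 1))"
      unfolding D_def i_l Z[symmetric]
      by (rule of_nat_two_terms_choose) (use low1 Z c q in simp_all)
    moreover have "(of_nat (q - c + 1) :: 'a) = 1"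
      by (simp only: of_nat_add q_c c0) simp
    ultimately have T1: "(of_nat (D choose (i + l)) :: 'a) = 1"
      by (simp add: minus)
    then have "i + l \<le> D"
      by (metis binomial_eq_0 linorder_not_less of_nat_0 zero_neq_one)
    then have "D - i = l + (D - (i + l))"
      by simp
    then have "(a ^ l + 1) * a ^ (D - (i + l)) = 0"
      using eq by (simp add: T0 T1 power_add algebra_simps)
    then have "a ^ l = 1"
      using a minus[of 1] by (simp add: add_eq_0_iff2)
    then show False
      using norm minus[of a] by simp
  qed
qed

section \<open>The individual degrees\<close>

text \<open>For prime \<open>q\<close> the characteristic is \<open>q\<close>, so
  \<open>j = 1\<close> in the field is a congruence modulo \<open>q\<close>.\<close>

lemma admissible_cong_1_mod_q:
  assumes "admissible r a j" "prime q" "odd q" "2 * j \<le> L + 1"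
  obtains c where "j = 1 + q * c"
proof -
  have "CHAR('a) = q"
    using CHAR_dvd_q prime_CHAR assms(2) primes_dvd_imp_eq by blast
  moreover have "(of_nat j :: 'a) = of_nat 1"
    using admissible_of_nat_eq_1[OF assms(1,3,4)] by simp
  ultimately have "[j = 1] (mod q)"
    by (metis of_nat_eq_iff_cong_CHAR)
  moreover have "1 \<le> j"
    using assms(1) by (simp add: admissible_def)
  ultimately obtain c where "j = c * q + 1"
    using cong_le_nat by blast
  then show thesis
    using that[of c] by (simp add: mult.commute)
qed

text \<open>Here \<open>ell q (e - 2) = 1\<close>, so every other \<open>j\<close> in the lower half
  is excluded with \<open>c = j - 1\<close>.\<close>

lemma admissible_small_3:
  assumes "e = 3" and adm: "admissible r a j" and j: "2 * j \<le> L + 1"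
  shows "j = 1"
proof (rule ccontr)
  assume "j \<noteq> 1"
  moreover have "1 \<le> j"
    using adm by (simp add: admissible_def)
  moreover have "L = 1 + q" and one: "ell q (e - 2) = 1"
    by (simp_all add: \<open>e = 3\<close> ell_def numeral_eq_Suc)
  ultimately have "j = 1 + (j - 1) * ell q (e - 2)" "1 \<le> j - 1" "2 * (j - 1) \<le> q"
    using j by simp_all
  from not_admissible_between[OF adm _ this] show False
    using \<open>e = 3\<close> by simp
qed

text \<open>Since \<open>l = (q + 1) * (1 + q ^ 2)\<close>, the row has the digit
  \<open>q - 1\<close> twice in base \<open>q ^ 2\<close>, and \<open>j = 1 + (q + 1) * c\<close>.
  As \<open>ell q 2 = q + 1\<close>, the general exclusion removes all \<open>c > 0\<close> in the
  lower half.\<close>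

lemma admissible_small_4:
  assumes "e = 4" and adm: "admissible r a j" and j: "2 * j \<le> L + 1"
  shows "j = 1"
proof -
  have L: "L = 1 + q * (q + 1)" and ell2: "ell q (e - 2) = q + 1"
    by (simp_all add: \<open>e = 4\<close> ell_def numeral_eq_Suc algebra_simps)
  have l: "l = (q + 1) * (1 + q ^ 2)"
    by (simp add: \<open>e = 4\<close> ell_def numeral_eq_Suc algebra_simps)
  have "(of_nat (((q - 1) * (1 + q ^ 2)) choose (u * (1 + q ^ 2))) :: 'a) \<noteq> 0" if "u < q" for u
  proof -
    have q2: "q \<le> q ^ 2"
      by (simp add: power2_eq_square)
    have "(of_nat (((q - 1) + q ^ 2 * (q - 1)) choose (u + q ^ 2 * u)) :: 'a) =
        of_nat ((q - 1) choose u) * of_nat ((q - 1) choose u)"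
      by (rule lucas_step) (use q2 that q_gt_1 in linarith)+
    then show ?thesis
      using that by (simp add: of_nat_q_minus_1_choose[unfolded One_nat_def] algebra_simps)
  qed
  then obtain c where c: "j = 1 + (q + 1) * c"
    using admissible_imp_cong_1_mod_q_plus_1[OF adm _ l] by auto
  have "c = 0"
  proof (rule ccontr)
    assume "c \<noteq> 0"
    have "(q + 1) * (2 * c) \<le> (q + 1) * q"
      using j unfolding c L by (simp add: algebra_simps)
    then have "2 * c \<le> q"
      by (rule mult_left_le_imp_le) simp
    moreover have "j = 1 + c * ell q (e - 2)"
      unfolding ell2 by (simp only: c mult.commute)
    ultimately show False
      using not_admissible_between[OF adm, of c] \<open>c \<noteq> 0\<close> \<open>e = 4\<close> by linarith
  qed
  then show ?thesis
    by (simp add: c)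
qed

text \<open>From \<open>j = 1 + q * c\<close> and
  \<open>(q + 1) * j \<le> L = (q + 1) * (q ^ 2 + 1)\<close> follows \<open>c \<le> q\<close>. The
  values strictly between 0 and \<open>q\<close> are excluded by one more sum; the end
  \<open>c = q\<close> is the exceptional \<open>j = q ^ 2 + 1\<close>.\<close>

lemma admissible_small_5:
  assumes "e = 5" "prime q" "odd q" and adm: "admissible r a j" and j: "2 * j \<le> L + 1"
  shows "j = 1 \<or> j = q ^ 2 + 1"
proof -
  obtain c where c: "j = 1 + q * c"
    using admissible_cong_1_mod_q[OF adm assms(2,3) j] by blast
  have L: "L = (q + 1) * (q ^ 2 + 1)"
    by (simp add: \<open>e = 5\<close> ell_def numeral_eq_Suc algebra_simps)
  have l: "l = 1 + q + q ^ 2 + q ^ 3 + q ^ 4"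
    by (simp add: \<open>e = 5\<close> ell_def numeral_eq_Suc algebra_simps)
  have "(q + 1) * j \<le> (q + 1) * (q ^ 2 + 1)"
    using admissible_imp_q_plus_1_times_le[OF adm _ j c] \<open>e = 5\<close> L by simp
  then have "j \<le> q ^ 2 + 1"
    by (rule mult_left_le_imp_le) simp
  then have "q * c \<le> q * q"
    by (simp add: c power2_eq_square)
  then have c_le: "c \<le> q"
    using q_gt_1 by simp
  have "\<not> (1 \<le> c \<and> c < q)"
  proof
    assume c1: "1 \<le> c \<and> c < q"
    define h where "h = (q + 1) div 2"
    have h: "2 * h = q + 1"
      using \<open>odd q\<close> by (simp add: h_def)
    have int_h: "2 * int h = int q + 1"
      using h by linarith
    have h2: "2 \<le> h"
      using h q_gt_1 by linarith
    \<comment> \<open>Because \<open>2 * h = q + 1\<close>, the row \<open>(q - 1) * k\<close> has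
      the base \<open>q\<close> digits \<open>h - 1, q - 1, h - 1, q - 1\<close>; an index whose
      digits do not exceed these has a nonzero coefficient.\<close>
    define k where "k = h + h * q + q ^ 3"
    define S where "S = (h - 1) + q * ((q - 1) + q * ((h - 1) + q * (q - 1)))"
    have S: "(q - 1) * k = S"
    proof -
      have "int ((q - 1) * k) = int S"
      proof -
        have qh: "int q = 2 * int h - 1"
          using h by linarith
        show ?thesis
          unfolding k_def S_def of_nat_mult of_nat_add of_nat_power
          using q_gt_1 h2 by (simp add: of_nat_diff qh algebra_simps power2_eq_square power3_eq_cube)
      qed
      then show ?thesis
        by (simp only: of_nat_eq_iff)
    qed
    have k: "0 < k"
      using h2 by (simp add: k_def)
    have S_less: "S < l"
    proof -
      have "S + 1 \<le> q ^ 4"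
      proof -
        have "int S + 1 \<le> int q ^ 4 - (int q - int h) - (int q - int h) * int q ^ 2"
          unfolding S_def of_nat_mult of_nat_add
          using q_gt_1 h2 by (simp add: of_nat_diff algebra_simps power2_eq_square power3_eq_cube power4_eq_xxxx)
        moreover have "0 \<le> (int q - int h) * int q ^ 2" "0 \<le> int q - int h"
          using h h2 by simp_all
        ultimately have "int S + 1 \<le> int q ^ 4"
          by linarith
        then show ?thesis
          by (metis of_nat_1 of_nat_add of_nat_le_iff of_nat_power)
      qed
      then show ?thesis
        unfolding l by linarith
    qed
    have int_l: "int l = 1 + int q + int q ^ 2 + int q ^ 3 + int q ^ 4"
      unfolding l by simp
    have qjk: "int q * int j * int k = int h * int q + int h * int q ^ 2 + int q ^ 4 +
        (int c * int h) * int q ^ 2 + (int c * int h) * int q ^ 3 + int c * int q ^ 5"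
      unfolding c k_def by (simp add: algebra_simps numeral_eq_Suc)
    have digits: "(of_nat (S choose (u0 + q * (u1 + q * (u2 + q * u3)))) :: 'a) \<noteq> 0"
      if "u0 \<le> h - 1" "u1 \<le> q - 1" "u2 \<le> h - 1" "u3 \<le> q - 1" for u0 u1 u2 u3
    proof -
      have "h - 1 < q" "q - 1 < q"
        using h h2 by linarith+
      then show ?thesis
        unfolding S_def using that of_nat_choose_neq_0[OF \<open>prime q\<close>]
        by (simp only: choose_digit[OF _ le_less_trans]) simp
    qed
    show False
    \<comment> \<open>Reducing \<open>c * h\<close> by \<open>2 * h = q + 1\<close> gives
      \<open>d * (q + 1)\<close> for \<open>c = 2 * d\<close> and \<open>d * (q + 1) + h\<close> for
      \<open>c = 2 * d + 1\<close>, hence two digit patterns for the index.\<close>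
    proof (cases "even c")
      case True
      then obtain d where d: "c = 2 * d"
        by blast
      have dh: "1 \<le> d" "d + 1 \<le> h"
        using c1 d h by linarith+
      define i where "i = (d - 1) + q * ((h - 1 - d) + q * ((h - 1) + q * (d - 1)))"
      have "int c * int h = int d * (2 * int h)"
        by (simp add: d)
      then have ch: "int c * int h = int d * (int q + 1)"
        by (simp only: int_h)
      have "int i = int q * int j * int k + int l * (- (int c * (int q - 1)) - (1 + int d))"
        unfolding qjk ch int_l i_def of_nat_mult of_nat_add
        using dh by (simp add: d of_nat_diff algebra_simps numeral_eq_Suc)
      then have "(of_nat (S choose i) :: 'a) = 0"
        by (rule admissible_imp_choose_eq_0[OF adm k S S_less])
      moreover have "(of_nat (S choose i) :: 'a) \<noteq> 0"
        unfolding i_def using dh h by (intro digits) linarith+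
      ultimately show False
        by simp
    next
      case False
      then obtain d where d: "c = 2 * d + 1"
        by (blast elim: oddE)
      have dh: "d + 2 \<le> h"
        using c1 d h \<open>odd q\<close> by presburger
      define i where "i = d + q * ((h - 1 - d) + q * (0 + q * (d + h)))"
      have "int c * int h = int d * (2 * int h) + int h"
        by (simp add: d distrib_right)
      then have ch: "int c * int h = int d * (int q + 1) + int h"
        by (simp only: int_h)
      \<comment> \<open>The last summand is zero by \<open>2 * h = q + 1\<close>; with it the
        identity holds between polynomials in \<open>q\<close>, \<open>h\<close> and
        \<open>d\<close>.\<close>
      have "int i = int q * int j * int k + int l * (- (int c * (int q - 1)) - (1 + int d)) +
          int q ^ 2 * (int q + 1 - 2 * int h)"
        unfolding qjk ch int_l i_def of_nat_mult of_nat_add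
        using dh by (simp add: d of_nat_diff algebra_simps numeral_eq_Suc)
      then have "int i = int q * int j * int k + int l * (- (int c * (int q - 1)) - (1 + int d))"
        by (simp add: int_h)
      then have "(of_nat (S choose i) :: 'a) = 0"
        by (rule admissible_imp_choose_eq_0[OF adm k S S_less])
      moreover have "(of_nat (S choose i) :: 'a) \<noteq> 0"
        unfolding i_def using dh h by (intro digits) linarith+
      ultimately show False
        by simp
    qed
  qed
  then have "c = 0 \<or> c = q"
    using c_le by linarith
  then show ?thesis
    by (auto simp: c power2_eq_square)
qed

text \<open>The congruences modulo \<open>q\<close> and \<open>q + 1\<close> combine to
  \<open>j = 1 + q * (q + 1) * d\<close>, the bound \<open>(q + 1) * j \<le> L\<close> gives
  \<open>d < q\<close>, and one more sum excludes \<open>d > 0\<close>.\<close>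

lemma admissible_small_6:
  assumes "e = 6" "prime q" "odd q" and adm: "admissible r a j" and j: "2 * j \<le> L + 1"
  shows "j = 1"
proof -
  obtain c where c: "j = 1 + q * c"
    using admissible_cong_1_mod_q[OF adm assms(2,3) j] by blast
  have L: "L = 1 + q + q ^ 2 + q ^ 3 + q ^ 4"
    by (simp add: \<open>e = 6\<close> ell_def numeral_eq_Suc algebra_simps)
  have l: "l = 1 + q + q ^ 2 + q ^ 3 + q ^ 4 + q ^ 5"
    by (simp add: \<open>e = 6\<close> ell_def numeral_eq_Suc algebra_simps)
  have l': "l = (q + 1) * (1 + q ^ 2 * (1 + q ^ 2))"
    by (simp add: \<open>e = 6\<close> ell_def numeral_eq_Suc algebra_simps)
  have "(of_nat (((q - 1) * (1 + q ^ 2 * (1 + q ^ 2))) choose (u * (1 + q ^ 2 * (1 + q ^ 2)))) :: 'a) \<noteq> 0"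
    if "u < q" for u
  proof -
    have q2: "q \<le> q ^ 2"
      by (simp add: power2_eq_square)
    have less: "q - 1 < q ^ 2" "u < q ^ 2"
      using q2 that q_gt_1 by linarith+
    have "(of_nat (((q - 1) + q ^ 2 * ((q - 1) + q ^ 2 * (q - 1))) choose (u + q ^ 2 * (u + q ^ 2 * u))) :: 'a) =
        of_nat ((q - 1) choose u) * (of_nat ((q - 1) choose u) * of_nat ((q - 1) choose u))"
      by (simp only: lucas_step[OF less])
    then show ?thesis
      using that by (simp add: of_nat_q_minus_1_choose[unfolded One_nat_def] algebra_simps)
  qed
  then obtain c' where c': "j = 1 + (q + 1) * c'"
    using admissible_imp_cong_1_mod_q_plus_1[OF adm _ l'] by auto
  have "q * c = (q + 1) * c'"
    using c c' by simp
  then have "q + 1 dvd q * c"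
    by (simp only: dvd_triv_left)
  then have "q + 1 dvd c"
    using q_plus_1_coprime_q coprime_dvd_mult_right_iff by blast
  then obtain d where d: "c = (q + 1) * d"
    by blast
  have j_eq: "j = 1 + q * (q + 1) * d"
    by (simp add: c d algebra_simps)
  have d_less: "d < q"
  proof (rule ccontr)
    assume "\<not> d < q"
    then have "(q + 1) * (1 + q * (q + 1) * q) \<le> (q + 1) * (1 + q * (q + 1) * d)"
      by (intro mult_left_mono add_left_mono) simp_all
    also have "\<dots> \<le> L"
      using admissible_imp_q_plus_1_times_le[OF adm _ j c] \<open>e = 6\<close> j_eq by simp
    finally show False
      unfolding L using q_gt_1 by (simp add: algebra_simps numeral_eq_Suc)
  qed
  have "d = 0"
  proof (rule ccontr)
    assume "d \<noteq> 0"
    then have d: "1 \<le> d"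
      by simp
    \<comment> \<open>From the lowest up, the row has the digits
      \<open>q - 1, q - 1, q - 2, 1, q - 1\<close>, and the index has \<open>q - 1 - d\<close> three
      times, then \<open>0\<close> and \<open>d - 1\<close>. The condition \<open>d \<ge> 1\<close>
      is what brings the third digit under \<open>q - 2\<close>.\<close>
    define k where "k = 1 + q + 2 * q ^ 2 + q ^ 4"
    define S where "S = (q - 1) + q * ((q - 1) + q * ((q - 2) + q * (1 + q * (q - 1))))"
    have S: "(q - 1) * k = S"
    proof -
      have "int ((q - 1) * k) = int S"
        unfolding k_def S_def of_nat_mult of_nat_add of_nat_power
        using q_gt_1 by (simp add: of_nat_diff algebra_simps numeral_eq_Suc)
      then show ?thesis
        by (simp only: of_nat_eq_iff)
    qed
    have k: "0 < k"
      by (simp add: k_def)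
    have S_less: "S < l"
    proof -
      have "int S = int q ^ 5 - int q ^ 4 + 2 * int q ^ 3 - int q ^ 2 - 1"
        unfolding S_def of_nat_mult of_nat_add
        using q_gt_1 by (simp add: of_nat_diff algebra_simps numeral_eq_Suc)
      moreover have "2 * int q ^ 3 \<le> int q * int q ^ 3"
        using q_gt_1 by (intro mult_right_mono) simp_all
      then have "2 * int q ^ 3 \<le> int q ^ 4"
        by (simp add: numeral_eq_Suc)
      moreover have "int l = 1 + int q + int q ^ 2 + int q ^ 3 + int q ^ 4 + int q ^ 5"
        unfolding l by simp
      moreover have "0 \<le> int q ^ 2" "0 \<le> int q ^ 3" "0 \<le> int q ^ 4"
        by simp_all
      ultimately have "int S < int l"
        by linarith
      then show ?thesis
        by simp
    qed
    define i where "i = (q - 1 - d) + q * ((q - 1 - d) + q * ((q - 1 - d) + q * (0 + q * (d - 1))))"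
    have "int i = int q * int j * int k + int l * (- (int d * int q ^ 2 + 1 + int d))"
      unfolding j_eq l k_def i_def of_nat_mult of_nat_add
      using d d_less q_gt_1 by (simp add: of_nat_diff algebra_simps numeral_eq_Suc)
    then have "(of_nat (S choose i) :: 'a) = 0"
      by (rule admissible_imp_choose_eq_0[OF adm k S S_less])
    moreover have "(of_nat (S choose i) :: 'a) \<noteq> 0"
    proof -
      have less: "q - 1 < q" "q - 2 < q" "1 < q" "q - 1 - d < q" "0 < q"
        using q_gt_1 by linarith+
      have "q - 1 - d \<le> q - 2" "d - 1 \<le> q - 1"
        using d d_less by linarith+
      then show ?thesis
        unfolding S_def i_def using of_nat_choose_neq_0[OF \<open>prime q\<close>] less
        by (simp only: choose_digit) simp
    qed
    ultimately show False
      by simp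
  qed
  then show ?thesis
    by (simp add: j_eq)
qed

section \<open>From \<open>j\<close> back to the residue of \<open>r\<close>\<close>

lemma bij_fpoly_iff:
  fixes a :: 'a
  assumes "0 < r" "a \<noteq> 0"
    and necessary: "\<And>j. admissible r a j \<Longrightarrow> r mod l \<in> R"
    and sufficient: "\<And>\<rho>. \<rho> \<in> R \<Longrightarrow> \<exists>m. [\<rho> * ell q m = 1] (mod l)"
  shows "bij (fpoly q r a) \<longleftrightarrow> (- a) ^ l \<noteq> 1 \<and> gcd r (q - 1) = 1 \<and> r mod l \<in> R"
proof
  assume bij: "bij (fpoly q r a)"
  obtain j where "admissible r a j"
    using bij_imp_admissible[OF bij assms(1,2)] by blast
  then show "(- a) ^ l \<noteq> 1 \<and> gcd r (q - 1) = 1 \<and> r mod l \<in> R"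
    using necessary bij_imp_norm_neq_1[OF bij assms(1)] bij_imp_coprime[OF bij assms(1)] by blast
next
  assume rhs: "(- a) ^ l \<noteq> 1 \<and> gcd r (q - 1) = 1 \<and> r mod l \<in> R"
  then obtain m where "[(r mod l) * ell q m = 1] (mod l)"
    using sufficient by blast
  then have "[r * ell q m = 1] (mod l)"
    unfolding cong_def by (simp only: mod_mult_left_eq)
  from bij_fpoly[OF assms(1) _ _ this] show "bij (fpoly q r a)"
    using rhs by simp
qed

text \<open>The mirrored \<open>j\<close> belongs to another polynomial, so the statement for the
  lower half is required for all \<open>r\<close> and \<open>a\<close>.\<close>

lemma admissible_by_symmetry:
  assumes adm: "admissible r a j"
    and small: "\<And>r a j. admissible r a j \<Longrightarrow> 2 * j \<le> L + 1 \<Longrightarrow> P j"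
  shows "P j \<or> P (L + 1 - j)"
proof (cases "2 * j \<le> L + 1")
  case False
  obtain r' a' where "admissible r' a' (L + 1 - j)"
    using admissible_mirror[OF adm] by blast
  then show ?thesis
    using small False by simp
qed (use assms in blast)

lemma admissible_residue:
  assumes adm: "admissible r a j" and "q * j + \<rho> = l"
  shows "r mod l = \<rho>"
proof -
  have "l dvd r + q * j" and j: "1 \<le> j"
    using adm by (auto simp: admissible_def)
  then have "[r + q * j = \<rho> + q * j] (mod l)"
    using assms(2) by (simp add: cong_def add.commute)
  then have "[r = \<rho>] (mod l)"
    by (simp only: cong_add_rcancel_nat)
  moreover have "0 < q * j"
    using j q_gt_1 by simp
  then have "\<rho> < l"
    using assms(2) by linarith
  ultimately show ?thesis
    by (simp add: cong_def)
qed

lemma L_ge_1: "1 \<le> L"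
  using e_ge_2 by (simp add: ell_pos Suc_le_eq)

lemma admissible_residue_1_or_L:
  assumes "admissible r a j" "j = 1 \<or> j = L"
  shows "r mod l \<in> {1, l - q}"
proof -
  have "q * 1 \<le> q * L"
    using L_ge_1 by (rule mult_le_mono2)
  then have "q * 1 + (l - q) = l"
    using l_eq(1) by linarith
  moreover have "q * L + 1 = l"
    using l_eq(1) by simp
  ultimately have "r mod l = l - q \<or> r mod l = 1"
    using assms(2) admissible_residue[OF assms(1)] by metis
  then show ?thesis
    by blast
qed

text \<open>The inverse of \<open>1\<close> is \<open>ell q 1\<close>; that of \<open>l - q\<close>
  is \<open>L\<close>, since \<open>q * L = l - 1\<close>.\<close>

lemma invertible_residue_1_or_l_minus_q:
  assumes "\<rho> \<in> {1, l - q}"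
  shows "\<exists>m. [\<rho> * ell q m = 1] (mod l)"
proof (cases "\<rho> = 1")
  case True
  then show ?thesis
    by (intro exI[of _ 1]) (simp add: ell_def)
next
  case False
  have "q * 1 \<le> q * L"
    using L_ge_1 by (rule mult_le_mono2)
  then have "q \<le> l"
    using l_eq(1) by linarith
  then have "int (l - q) = int l - int q"
    by (rule of_nat_diff)
  then have "int ((l - q) * L) = 1 + int l * (int L - 1)"
    using int_l_eq by (simp add: algebra_simps)
  then have "[int ((l - q) * L) = int 1] (mod int l)"
    by (simp add: cong_iff_dvd_diff)
  then have "[(l - q) * L = 1] (mod l)"
    by (simp only: cong_int_iff)
  then show ?thesis
    using False assms by blast
qed

lemma admissible_small:
  assumes e: "e \<in> {2, 3, 4} \<or> e = 6 \<and> prime q \<and> odd q"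
    and adm: "admissible r a j" and j: "2 * j \<le> L + 1"
  shows "j = 1"
proof -
  consider "e = 2" | "e = 3" | "e = 4" | "e = 6" "prime q" "odd q"
    using e by auto
  then show ?thesis
  proof cases
    case 1
    then have "L = 1"
      by (simp add: ell_def)
    then show ?thesis
      using adm unfolding admissible_def by linarith
  next
    case 2
    then show ?thesis
      using adm j by (rule admissible_small_3)
  next
    case 3
    then show ?thesis
      using adm j by (rule admissible_small_4)
  next
    case 4
    then show ?thesis
      using adm j by (rule admissible_small_6)
  qed
qed

lemma bij_fpoly_iff_two_residues:
  fixes a :: 'a
  assumes "0 < r" "a \<noteq> 0"
    and e: "e \<in> {2, 3, 4} \<or> e = 6 \<and> prime q \<and> odd q"
  shows "bij (fpoly q r a) \<longleftrightarrow> (- a) ^ l \<noteq> 1 \<and> gcd r (q - 1) = 1 \<and> r mod l \<in> {1, l - q}"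
proof (rule bij_fpoly_iff[OF assms(1,2)])
  fix j
  assume adm: "admissible r a j"
  then have "j = 1 \<or> L + 1 - j = 1"
    by (rule admissible_by_symmetry[where P = "\<lambda>j. j = 1"]) (rule admissible_small[OF e])
  moreover have "j \<le> L"
    using adm by (simp add: admissible_def)
  ultimately have "j = 1 \<or> j = L"
    by linarith
  then show "r mod l \<in> {1, l - q}"
    by (rule admissible_residue_1_or_L[OF adm])
qed (rule invertible_residue_1_or_l_minus_q)

text \<open>The exceptional \<open>j = q ^ 2 + 1\<close> and its mirror image
  \<open>q ^ 3 + q + 1\<close> account for the residues \<open>q ^ 4 + q ^ 2 + 1\<close> and
  \<open>q ^ 3 + 1\<close>, whose inverses modulo \<open>l\<close> are \<open>ell q 2\<close> and
  \<open>ell q 3\<close>.\<close>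

lemma bij_fpoly_iff_5:
  fixes a :: 'a
  assumes "e = 5" "prime q" "odd q" "0 < r" "a \<noteq> 0"
  shows "bij (fpoly q r a) \<longleftrightarrow> (- a) ^ l \<noteq> 1 \<and> gcd r (q - 1) = 1 \<and>
    r mod l \<in> {1, l - q, q ^ 3 + 1, q ^ 4 + q ^ 2 + 1}"
proof (rule bij_fpoly_iff[OF assms(4,5)])
  have L: "L = 1 + q + q ^ 2 + q ^ 3"
    by (simp add: \<open>e = 5\<close> ell_def numeral_eq_Suc algebra_simps)
  have l: "l = 1 + q + q ^ 2 + q ^ 3 + q ^ 4"
    by (simp add: \<open>e = 5\<close> ell_def numeral_eq_Suc algebra_simps)
  {
    fix j
    assume adm: "admissible r a j"
    then have "(j = 1 \<or> j = q ^ 2 + 1) \<or> (L + 1 - j = 1 \<or> L + 1 - j = q ^ 2 + 1)"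
      by (rule admissible_by_symmetry[where P = "\<lambda>j. j = 1 \<or> j = q ^ 2 + 1"])
        (rule admissible_small_5[OF assms(1,2,3)])
    moreover have "j \<le> L"
      using adm by (simp add: admissible_def)
    ultimately consider "j = 1 \<or> j = L" | "j = q ^ 2 + 1" | "j = q ^ 3 + q + 1"
      using L by linarith
    then show "r mod l \<in> {1, l - q, q ^ 3 + 1, q ^ 4 + q ^ 2 + 1}"
    proof cases
      case 1
      then show ?thesis
        using admissible_residue_1_or_L[OF adm] by blast
    next
      case 2
      have "r mod l = q ^ 4 + q ^ 2 + 1"
        by (rule admissible_residue[OF adm]) (simp add: 2 l algebra_simps numeral_eq_Suc)
      then show ?thesis
        by simp
    next
      case 3
      have "r mod l = q ^ 3 + 1"
        by (rule admissible_residue[OF adm]) (simp add: 3 l algebra_simps numeral_eq_Suc)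
      then show ?thesis
        by simp
    qed
  }
  have "int ((q ^ 3 + 1) * ell q 3) = 1 + int l * int q"
    "int ((q ^ 4 + q ^ 2 + 1) * ell q 2) = 1 + int l * int q"
    unfolding l by (simp_all add: ell_def algebra_simps numeral_eq_Suc)
  then have "[int ((q ^ 3 + 1) * ell q 3) = int 1] (mod int l)"
    "[int ((q ^ 4 + q ^ 2 + 1) * ell q 2) = int 1] (mod int l)"
    by (simp_all add: cong_iff_dvd_diff)
  then have "[(q ^ 3 + 1) * ell q 3 = 1] (mod l)" "[(q ^ 4 + q ^ 2 + 1) * ell q 2 = 1] (mod l)"
    by (simp_all only: cong_int_iff)
  then show "\<exists>m. [\<rho> * ell q m = 1] (mod l)" if "\<rho> \<in> {1, l - q, q ^ 3 + 1, q ^ 4 + q ^ 2 + 1}" for \<rho>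
    using that invertible_residue_1_or_l_minus_q[of \<rho>] by (elim insertE) auto
qed

end

theorem theorem1p3:
  fixes a :: "'a::{field,finite}" and q e r :: nat
  assumes "primepow q"
    and "card (UNIV :: 'a set) = q ^ e"
    and "2 \<le> e" and "e \<le> 6"
    and "r > 0"
    and "a \<noteq> 0"
  shows "(e \<in> {2,3,4} \<longrightarrow>
            (bij (fpoly q r a) \<longleftrightarrow>
               (-a) ^ ell q e \<noteq> 1 \<and> gcd r (q - 1) = 1 \<and>
               r mod ell q e \<in> {1, ell q e - q}))
       \<and> (e = 5 \<and> prime q \<and> odd q \<longrightarrow>
            (bij (fpoly q r a) \<longleftrightarrow>
               (-a) ^ ell q e \<noteq> 1 \<and> gcd r (q - 1) = 1 \<and>
               r mod ell q e \<in> {1, ell q e - q, q^3 + 1, q^4 + q^2 + 1}))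
       \<and> (e = 6 \<and> prime q \<and> odd q \<longrightarrow>
            (bij (fpoly q r a) \<longleftrightarrow>
               (-a) ^ ell q e \<noteq> 1 \<and> gcd r (q - 1) = 1 \<and>
               r mod ell q e \<in> {1, ell q e - q}))"
proof -
  have field: "finite_field_extension TYPE('a) q e"
    using assms(1-3) by (rule finite_field_extension.intro)
  note two = finite_field_extension.bij_fpoly_iff_two_residues[OF field assms(5,6)]
  note four = finite_field_extension.bij_fpoly_iff_5[OF field _ _ _ assms(5,6)]
  show ?thesis
    by (intro conjI impI; (rule two | rule four); blast)
qed

end
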